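(* Let $G$ be a finite simple graph on $n$ vertices with at least one edge, and let $M(G)$ be the multiplicity of $x=-1$ as a root of the independence polynomial $P_G(x)$. Then $$\mathfrak{a}(R/J(G))=\mathfrak{a}(R/I(G))=-M(G).$$
   Context: $\Bbbk$ is a field and $R=\Bbbk[x_1,\dots,x_n]$ with the standard grading, the variables being indexed by the vertices $1,\dots,n$ of $G$. The edge ideal is $I(G)=(x_ix_j:\{i,j\}\in E(G))$ and the cover ideal is $J(G)=\bigl(\prod_{i\in C}x_i : C \text{ a minimal vertex cover of } G\bigr)=\bigcap_{\{i,j\}\in E(G)}(x_i,x_j)$. For a standard graded $\Bbbk$-algebra $A$ with Hilbert series $H_A(t)$, the $h$-polynomial $h_A(t)\in\mathbb{Z}[t]$ is the unique polynomial with $H_A(t)=h_A(t)/(1-t)^{\dim A}$, and the $\mathfrak{a}$-invariant is $\mathfrak{a}(A)=\deg h_A(t)-\dim A$. The independence polynomial is $P_G(x)=\sum_{i\ge0}g_ix^i\in\mathbb{Z}[x]$, where $g_i$ is the number of independent sets of $G$ of size $i$; $M(G)$ is the multiplicity of $-1$ as a root of $P_G(x)$ over $\mathbb{Q}$ ($0$ if $P_G(-1)\neq0$). *)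

theory Defs
  imports
    "HOL-Algebra.Algebra"
    "HOL-Algebra.Algebraic_Closure_Type"
    "HOL-Library.Poly_Mapping"
    "HOL-Library.Extended_Nat"
    "HOL-Computational_Algebra.Computational_Algebra"
begin

section \<open>Graphs on the vertex set UNIV\<close>

text \<open>
  A graph is given by its set of edges; its vertices are all the elements of the finite type
  \<open>'v\<close>, so the number of vertices is \<open>card (UNIV :: 'v set)\<close>.
\<close>

definition simple_graph :: "'v::finite set set \<Rightarrow> bool" where
  "simple_graph E \<longleftrightarrow> (\<forall>e\<in>E. card e = 2)"

definition independent_set :: "'v set set \<Rightarrow> 'v set \<Rightarrow> bool" where
  "independent_set E S \<longleftrightarrow> (\<forall>e\<in>E. \<not> e \<subseteq> S)"

definition vertex_cover :: "'v set set \<Rightarrow> 'v set \<Rightarrow> bool" where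
  "vertex_cover E C \<longleftrightarrow> (\<forall>e\<in>E. e \<inter> C \<noteq> {})"

definition minimal_vertex_cover :: "'v set set \<Rightarrow> 'v set \<Rightarrow> bool" where
  "minimal_vertex_cover E C \<longleftrightarrow> vertex_cover E C \<and> (\<forall>D. D \<subset> C \<longrightarrow> \<not> vertex_cover E D)"

definition independence_poly :: "'v::finite set set \<Rightarrow> int poly" where
  "independence_poly E =
     (\<Sum>i\<le>card (UNIV :: 'v set). Polynomial.monom (int (card {S. independent_set E S \<and> card S = i})) i)"

definition multiplicity_minus_one :: "'v::finite set set \<Rightarrow> nat" where
  "multiplicity_minus_one E = Polynomial.order (- 1) (map_poly rat_of_int (independence_poly E))"


section \<open>The polynomial ring and its monomial ideals\<close>

text \<open>Polynomials are finitely supported functions from exponent vectors to coefficients.\<close>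

type_synonym ('v, 'k) mpoly = "('v \<Rightarrow>\<^sub>0 nat) \<Rightarrow>\<^sub>0 'k"

abbreviation mpoly_ring :: "('v, 'k::field) mpoly ring" where
  "mpoly_ring \<equiv> ring_of_type_algebra"

definition var :: "'v \<Rightarrow> ('v, 'k::field) mpoly" where
  "var v = Poly_Mapping.single (Poly_Mapping.single v 1) 1"

definition const :: "'k::field \<Rightarrow> ('v, 'k) mpoly" where
  "const c = Poly_Mapping.single 0 c"

definition homogeneous_component :: "nat \<Rightarrow> ('v::finite, 'k::field) mpoly set" where
  "homogeneous_component d = {p. \<forall>m\<in>Poly_Mapping.keys p. (\<Sum>v\<in>UNIV. Poly_Mapping.lookup m v) = d}"

definition edge_ideal :: "'v::finite set set \<Rightarrow> ('v, 'k::field) mpoly set" where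
  "edge_ideal E = Idl\<^bsub>mpoly_ring\<^esub> {var i * var j | i j. {i, j} \<in> E}"

definition cover_ideal :: "'v::finite set set \<Rightarrow> ('v, 'k::field) mpoly set" where
  "cover_ideal E = Idl\<^bsub>mpoly_ring\<^esub> {\<Prod>i\<in>C. var i | C. minimal_vertex_cover E C}"


section \<open>Hilbert series, Krull dimension and the a-invariant\<close>

text \<open>
  A standard graded algebra is presented as the quotient of the polynomial ring by a proper
  homogeneous ideal \<open>I\<close>. Its graded pieces are the images of the homogeneous components, and
  its scalars are the images of the constants; for a proper ideal these form a subfield, over
  which \<^const>\<open>ring.dim\<close> is the vector space dimension.
\<close>

definition quot_component :: "('v::finite, 'k::field) mpoly set \<Rightarrow> nat \<Rightarrow> ('v, 'k) mpoly set set" where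
  "quot_component I d = (\<lambda>p. I +>\<^bsub>mpoly_ring\<^esub> p) ` homogeneous_component d"

definition quot_scalars :: "('v::finite, 'k::field) mpoly set \<Rightarrow> ('v, 'k) mpoly set set" where
  "quot_scalars I = range (\<lambda>c. I +>\<^bsub>mpoly_ring\<^esub> const c)"

definition hilbert_function :: "('v::finite, 'k::field) mpoly set \<Rightarrow> nat \<Rightarrow> nat" where
  "hilbert_function I d = ring.dim (mpoly_ring Quot I) (quot_scalars I) (quot_component I d)"

definition hilbert_series :: "('v::finite, 'k::field) mpoly set \<Rightarrow> int fps" where
  "hilbert_series I = Abs_fps (\<lambda>d. int (hilbert_function I d))"

text \<open>Supremum of the lengths \<open>m\<close> of chains of prime ideals \<open>P 0 \<subset> \<dots> \<subset> P m\<close>.\<close>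

definition krull_dim :: "('a, 'b) ring_scheme \<Rightarrow> enat" where
  "krull_dim A = Sup {enat m | m. \<exists>P :: nat \<Rightarrow> 'a set.
     (\<forall>i\<le>m. primeideal (P i) A) \<and> (\<forall>i<m. P i \<subset> P (Suc i))}"

definition quot_dim :: "('v::finite, 'k::field) mpoly set \<Rightarrow> nat" where
  "quot_dim I = the_enat (krull_dim (mpoly_ring Quot I))"

text \<open>
  \<^term>\<open>1 - fps_X :: int fps\<close> is a unit, so the defining equation is the usual
  \<open>H(t) = h(t) / (1 - t) ^ dim\<close>; division of power series is only available over fields.
\<close>

definition h_poly :: "('v::finite, 'k::field) mpoly set \<Rightarrow> int poly" where
  "h_poly I = (THE h. hilbert_series I * (1 - fps_X) ^ quot_dim I = fps_of_poly h)"

definition a_invariant :: "('v::finite, 'k::field) mpoly set \<Rightarrow> int" where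
  "a_invariant I = int (Polynomial.degree (h_poly I)) - int (quot_dim I)"

end

theory Submission
  imports Defs
begin

text \<open>
  Both ideals are generated by squarefree monomials, so each is the Stanley-Reisner ideal of a
  simplicial complex on the vertices: the complex of independent sets for the edge ideal, and the
  complex of sets that are not vertex covers for the cover ideal
  (\<open>edge_ideal_stanley_reisner\<close>, \<open>cover_ideal_stanley_reisner\<close>). The proof computes
  the a-invariant of an arbitrary Stanley-Reisner ring from its face polynomial
  \<open>f(x) = \<Sum>S\<in>\<Delta>. x ^ card S\<close>, and then compares the face polynomials of the
  two complexes.

  The monomials supported on faces form a basis of \<open>R / I\<close>. Sorting them by support gives
  the Hilbert series \<open>f(t / (1 - t))\<close>, and the Krull dimension \<open>D\<close> is the largest
  cardinality of a face (\<open>quot_dim_stanley_reisner\<close>). So the h-polynomial is the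
  homogenisation of \<open>f\<close> in degree \<open>D\<close>, evaluated at \<open>(t, 1 - t)\<close>. If
  \<open>f(x) = (1 + x) ^ M * q(x)\<close> with \<open>q(-1) \<noteq> 0\<close>, each factor \<open>1 + x\<close>
  homogenises to \<open>t + (1 - t) = 1\<close> and disappears, and what is left has degree exactly
  \<open>D - M\<close> because its coefficient in that degree is \<open>q(-1)\<close> up to sign. Hence the
  a-invariant is \<open>-M\<close> (\<open>a_invariant_stanley_reisner\<close>).

  For the edge ideal, \<open>f\<close> is the independence polynomial \<open>P\<close>. For the cover ideal,
  complementation turns sets that are not covers into sets that are not independent, whence
  \<open>f(x) = (1 + x) ^ n - x ^ n * P(1 / x)\<close>. The second summand vanishes at \<open>-1\<close> to the
  same order \<open>M\<close> as \<open>P\<close>. As the graph has an edge, \<open>M \<le> degree P < n\<close>, so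
  the first summand vanishes to higher order and the order of \<open>f\<close> is again \<open>M\<close>
  (\<open>order_face_poly_noncovers\<close>).

  The Krull dimension is bounded from below by a chain of ideals generated by variables. The upper
  bound follows Coquand and Lombardi: a longer chain of primes would provide more than \<open>D\<close>
  elements \<open>y i \<in> P (Suc i) - P i\<close>, which satisfy a polynomial relation modulo \<open>I\<close>
  since the dimension of the space of residue classes of bounded degree grows only like the
  \<open>D\<close>-th power of the degree (\<open>algebraic_relation_exists\<close>), while the lexicographically
  least monomial of a relation shows that it cannot lie in the first prime of the chain
  (\<open>prime_chain_no_relation\<close>).
\<close>

section \<open>Ideals, primes and quotients in the ring of a type\<close>

lemma type_algebra_simps [simp]:
  "carrier (ring_of_type_algebra :: 'a::ring_1 ring) = UNIV"
  "monoid.mult (ring_of_type_algebra :: 'a ring) = (*)"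
  "monoid.one (ring_of_type_algebra :: 'a ring) = 1"
  "ring.zero (ring_of_type_algebra :: 'a ring) = 0"
  "ring.add (ring_of_type_algebra :: 'a ring) = (+)"
  by (simp_all add: ring_of_type_algebra_def)

lemma a_inv_type_algebra [simp]:
  "a_inv (ring_of_type_algebra :: 'a::comm_ring_1 ring) x = - x"
proof -
  interpret ring "ring_of_type_algebra :: 'a ring" by (rule ring_from_type_algebra)
  show ?thesis using minus_equality[of "- x" x] by simp
qed

lemma a_minus_type_algebra [simp]:
  "a_minus (ring_of_type_algebra :: 'a::comm_ring_1 ring) x y = x - y"
  by (simp add: a_minus_def)

lemma ideal_type_algebraI:
  fixes I :: "'a::comm_ring_1 set"
  assumes "0 \<in> I" and add: "\<And>x y. x \<in> I \<Longrightarrow> y \<in> I \<Longrightarrow> x + y \<in> I"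
    and mult: "\<And>x r. x \<in> I \<Longrightarrow> r * x \<in> I"
  shows "ideal I (ring_of_type_algebra :: 'a ring)"
proof (rule idealI)
  show "ring (ring_of_type_algebra :: 'a ring)" by (rule ring_from_type_algebra)
  then interpret ring "ring_of_type_algebra :: 'a ring" .
  have "\<And>x. x \<in> I \<Longrightarrow> - x \<in> I" using mult[of _ "- 1"] by simp
  then show "subgroup I (add_monoid (ring_of_type_algebra :: 'a ring))"
    using assms by (intro add.subgroupI) (auto simp flip: a_inv_def)
qed (use mult in \<open>auto simp: mult.commute\<close>)

lemma ideal_type_algebraD:
  fixes I :: "'a::comm_ring_1 set"
  assumes "ideal I (ring_of_type_algebra :: 'a ring)"
  shows "0 \<in> I" and "x \<in> I \<Longrightarrow> y \<in> I \<Longrightarrow> x + y \<in> I" and "x \<in> I \<Longrightarrow> r * x \<in> I"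
    and "x \<in> I \<Longrightarrow> y \<in> I \<Longrightarrow> x - y \<in> I"
proof -
  interpret ideal I "ring_of_type_algebra :: 'a ring" by fact
  show 0: "0 \<in> I" and 1: "x \<in> I \<Longrightarrow> y \<in> I \<Longrightarrow> x + y \<in> I" for x y
    using additive_subgroup.zero_closed[OF is_additive_subgroup] additive_subgroup.a_closed[OF is_additive_subgroup]
    by auto
  show 2: "x \<in> I \<Longrightarrow> r * x \<in> I" for x r
    using I_l_closed[of x r] by simp
  show "x \<in> I \<Longrightarrow> y \<in> I \<Longrightarrow> x - y \<in> I"
    using 1[of x "- y"] 2[of y "- 1"] by simp
qed

lemma ideal_sum_type_algebra:
  fixes I :: "'a::comm_ring_1 set"
  assumes "ideal I (ring_of_type_algebra :: 'a ring)" "\<And>i. i \<in> A \<Longrightarrow> f i \<in> I"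
  shows "(\<Sum>i\<in>A. f i) \<in> I"
  using assms(2) by (induction A rule: infinite_finite_induct)
    (auto intro: ideal_type_algebraD[OF assms(1)])

lemma quot_type_algebra:
  fixes I :: "'a::comm_ring_1 set"
  assumes I: "ideal I (ring_of_type_algebra :: 'a ring)"
  defines "R \<equiv> ring_of_type_algebra :: 'a ring"
  shows "carrier (R Quot I) = range (\<lambda>p. I +>\<^bsub>R\<^esub> p)"
    and "(I +>\<^bsub>R\<^esub> p) \<otimes>\<^bsub>R Quot I\<^esub> (I +>\<^bsub>R\<^esub> q) = I +>\<^bsub>R\<^esub> (p * q)"
    and "(I +>\<^bsub>R\<^esub> p) \<oplus>\<^bsub>R Quot I\<^esub> (I +>\<^bsub>R\<^esub> q) = I +>\<^bsub>R\<^esub> (p + q)"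
    and "\<zero>\<^bsub>R Quot I\<^esub> = I +>\<^bsub>R\<^esub> 0"
    and "\<one>\<^bsub>R Quot I\<^esub> = I +>\<^bsub>R\<^esub> 1"
    and "I +>\<^bsub>R\<^esub> p = I +>\<^bsub>R\<^esub> q \<longleftrightarrow> p - q \<in> I"
proof -
  interpret ideal I R using I by (simp add: R_def)
  show "carrier (R Quot I) = range (\<lambda>p. I +>\<^bsub>R\<^esub> p)"
    by (auto simp: FactRing_def A_RCOSETS_def' R_def)
  show "(I +>\<^bsub>R\<^esub> p) \<otimes>\<^bsub>R Quot I\<^esub> (I +>\<^bsub>R\<^esub> q) = I +>\<^bsub>R\<^esub> (p * q)"
    using rcoset_mult_add[of p q] by (simp add: FactRing_def R_def)
  show "(I +>\<^bsub>R\<^esub> p) \<oplus>\<^bsub>R Quot I\<^esub> (I +>\<^bsub>R\<^esub> q) = I +>\<^bsub>R\<^esub> (p + q)"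
    using a_rcos_sum[of p q] by (simp add: FactRing_def R_def)
  show "\<zero>\<^bsub>R Quot I\<^esub> = I +>\<^bsub>R\<^esub> 0"
    using a_rcos_zero[OF is_ideal additive_subgroup.zero_closed[OF is_additive_subgroup]] by (simp add: FactRing_def R_def)
  show "\<one>\<^bsub>R Quot I\<^esub> = I +>\<^bsub>R\<^esub> 1" by (simp add: FactRing_def R_def)
  show "I +>\<^bsub>R\<^esub> p = I +>\<^bsub>R\<^esub> q \<longleftrightarrow> p - q \<in> I"
    using quotient_eq_iff_same_a_r_cos[OF is_ideal, of p q] by (simp add: R_def)
qed

lemma primeideal_type_algebraD:
  fixes P :: "'a::comm_ring_1 set"
  assumes "primeideal P (ring_of_type_algebra :: 'a ring)"
  shows "ideal P (ring_of_type_algebra :: 'a ring)" and "1 \<notin> P"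
    and "x * y \<in> P \<Longrightarrow> x \<in> P \<or> y \<in> P" and "x ^ n \<in> P \<Longrightarrow> x \<in> P"
proof -
  interpret primeideal P "ring_of_type_algebra :: 'a ring" by fact
  show I: "ideal P (ring_of_type_algebra :: 'a ring)" by (rule is_ideal)
  show 1: "1 \<notin> P" using one_imp_carrier I_notcarr by auto
  show 2: "x * y \<in> P \<Longrightarrow> x \<in> P \<or> y \<in> P" for x y using I_prime[of x y] by simp
  show "x ^ n \<in> P \<Longrightarrow> x \<in> P" using 1 2 by (induction n) auto
qed

lemma primeideal_quot_vimage:
  fixes I :: "'a::comm_ring_1 set"
  assumes I: "ideal I (ring_of_type_algebra :: 'a ring)"
    and P: "primeideal P ((ring_of_type_algebra :: 'a ring) Quot I)"
  shows "primeideal {p. I +>\<^bsub>ring_of_type_algebra\<^esub> p \<in> P} (ring_of_type_algebra :: 'a ring)"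
proof (rule primeidealI)
  let ?R = "ring_of_type_algebra :: 'a ring"
  note Q = quot_type_algebra[OF I]
  interpret h: ring_hom_ring ?R "?R Quot I" "\<lambda>p. I +>\<^bsub>?R\<^esub> p"
    using I by (rule ideal.rcos_ring_hom_ring)
  have P': "ideal P (?R Quot I)" using P by (simp add: primeideal.axioms(1))
  show "ideal {p. I +>\<^bsub>?R\<^esub> p \<in> P} ?R" using h.ideal_vimage[OF P'] by simp
  show "cring ?R" by (rule cring_from_type_algebra)
  show "carrier ?R \<noteq> {p. I +>\<^bsub>?R\<^esub> p \<in> P}"
  proof
    assume "carrier ?R = {p. I +>\<^bsub>?R\<^esub> p \<in> P}"
    then have "carrier (?R Quot I) \<subseteq> P" unfolding Q(1) by auto
    then have "carrier (?R Quot I) = P"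
      using additive_subgroup.a_subset[OF ideal.axioms(1)[OF P']] by blast
    then show False using primeideal.I_notcarr[OF P] by simp
  qed
  fix a b assume "a \<otimes>\<^bsub>?R\<^esub> b \<in> {p. I +>\<^bsub>?R\<^esub> p \<in> P}"
  then have "(I +>\<^bsub>?R\<^esub> a) \<otimes>\<^bsub>?R Quot I\<^esub> (I +>\<^bsub>?R\<^esub> b) \<in> P" unfolding Q(2) by simp
  then have "I +>\<^bsub>?R\<^esub> a \<in> P \<or> I +>\<^bsub>?R\<^esub> b \<in> P"
    by (rule primeideal.I_prime[OF P, rotated 2]) (unfold Q(1), auto)
  then show "a \<in> {p. I +>\<^bsub>?R\<^esub> p \<in> P} \<or> b \<in> {p. I +>\<^bsub>?R\<^esub> p \<in> P}" by simp
qed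

lemma primeideal_quot_image:
  fixes I :: "'a::comm_ring_1 set"
  assumes I: "ideal I (ring_of_type_algebra :: 'a ring)"
    and P: "primeideal P (ring_of_type_algebra :: 'a ring)" and sub: "I \<subseteq> P"
  shows "primeideal ((\<lambda>p. I +>\<^bsub>ring_of_type_algebra\<^esub> p) ` P) ((ring_of_type_algebra :: 'a ring) Quot I)"
    and "I +>\<^bsub>ring_of_type_algebra\<^esub> p \<in> (\<lambda>p. I +>\<^bsub>ring_of_type_algebra\<^esub> p) ` P \<longleftrightarrow> p \<in> P"
proof -
  let ?R = "ring_of_type_algebra :: 'a ring"
  let ?h = "\<lambda>p. I +>\<^bsub>?R\<^esub> p"
  note Q = quot_type_algebra[OF I]
  note P' = primeideal_type_algebraD[OF P]
  interpret ring ?R by (rule ring_from_type_algebra)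
  show mem: "?h p \<in> ?h ` P \<longleftrightarrow> p \<in> P" for p
  proof
    assume "?h p \<in> ?h ` P"
    then obtain q where "q \<in> P" "p - q \<in> P" using Q(6) sub by blast
    then show "p \<in> P" using ideal_type_algebraD(2)[OF P'(1)] by fastforce
  qed auto
  show "primeideal (?h ` P) (?R Quot I)"
  proof (rule primeidealI)
    show "ideal (?h ` P) (?R Quot I)" using I P'(1) by (rule ring_ideal_imp_quot_ideal)
    show "cring (?R Quot I)" using I cring_from_type_algebra by (rule ideal.quotient_is_cring)
    show "carrier (?R Quot I) \<noteq> ?h ` P" using mem[of 1] P'(2) unfolding Q(1) by blast
    fix a b assume "a \<in> carrier (?R Quot I)" "b \<in> carrier (?R Quot I)" "a \<otimes>\<^bsub>?R Quot I\<^esub> b \<in> ?h ` P"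
    moreover from this obtain r s where rs: "a = ?h r" "b = ?h s" unfolding Q(1) by blast
    ultimately have "?h (r * s) \<in> ?h ` P" by (simp only: Q(2))
    then have "r * s \<in> P" by (simp only: mem)
    then show "a \<in> ?h ` P \<or> b \<in> ?h ` P" unfolding rs using P'(3) by blast
  qed
qed

section \<open>Squarefree monomial ideals\<close>

text \<open>
  The empty face is part of the definition because it is what makes the associated ideal proper.
\<close>
definition simplicial_complex :: "'v set set \<Rightarrow> bool" where
  "simplicial_complex \<Delta> \<longleftrightarrow> {} \<in> \<Delta> \<and> (\<forall>S\<in>\<Delta>. \<forall>T. T \<subseteq> S \<longrightarrow> T \<in> \<Delta>)"

definition stanley_reisner_ideal :: "'v set set \<Rightarrow> ('v, 'k::field) mpoly set" where
  "stanley_reisner_ideal \<Delta> = {p. \<forall>m\<in>Poly_Mapping.keys p. Poly_Mapping.keys m \<notin> \<Delta>}"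

lemma keys_add_nat:
  "Poly_Mapping.keys (a + b :: 'v \<Rightarrow>\<^sub>0 nat) = Poly_Mapping.keys a \<union> Poly_Mapping.keys b"
  by (auto simp: in_keys_iff lookup_add)

lemma monomial_ideal_upclosed:
  assumes up: "\<And>m n :: 'v \<Rightarrow>\<^sub>0 nat. m \<in> U \<Longrightarrow> n + m \<in> U"
  shows "ideal {p. Poly_Mapping.keys p \<subseteq> U} (mpoly_ring :: ('v, 'k::field) mpoly ring)"
proof (rule ideal_type_algebraI)
  fix p q :: "('v, 'k) mpoly"
  assume p: "p \<in> {p. Poly_Mapping.keys p \<subseteq> U}"
  then show "q * p \<in> {p. Poly_Mapping.keys p \<subseteq> U}"
    using keys_mult[of q p] up by blast
  assume "q \<in> {p. Poly_Mapping.keys p \<subseteq> U}"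
  with p show "p + q \<in> {p. Poly_Mapping.keys p \<subseteq> U}"
    using keys_add[of p q] by blast
qed auto

lemma ideal_stanley_reisner:
  assumes "simplicial_complex \<Delta>"
  shows "ideal (stanley_reisner_ideal \<Delta> :: ('v, 'k::field) mpoly set) mpoly_ring"
proof -
  have "ideal {p. Poly_Mapping.keys p \<subseteq> {m. Poly_Mapping.keys m \<notin> \<Delta>}}
      (mpoly_ring :: ('v, 'k) mpoly ring)"
    using assms by (intro monomial_ideal_upclosed) (auto simp: simplicial_complex_def keys_add_nat)
  moreover have "{p. Poly_Mapping.keys p \<subseteq> {m. Poly_Mapping.keys m \<notin> \<Delta>}}
      = (stanley_reisner_ideal \<Delta> :: ('v, 'k) mpoly set)"
    by (auto simp: stanley_reisner_ideal_def)
  ultimately show ?thesis by simp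
qed

lemma poly_mapping_sum_single:
  "(\<Sum>m\<in>Poly_Mapping.keys p. Poly_Mapping.single m (Poly_Mapping.lookup p m)) = p"
  by (rule poly_mapping_eqI) (auto simp: lookup_sum lookup_single when_def in_keys_iff sum.If_cases)

lemma prod_var:
  "(\<Prod>i\<in>G. var i :: ('v::finite, 'k::field) mpoly)
    = Poly_Mapping.single (\<Sum>i\<in>G. Poly_Mapping.single i 1) 1"
  by (induction G rule: infinite_finite_induct) (auto simp: var_def mult_single)

lemma lookup_sum_single:
  "finite G \<Longrightarrow> Poly_Mapping.lookup (\<Sum>i\<in>G. Poly_Mapping.single i (1::nat)) v = (if v \<in> G then 1 else 0)"
  by (simp add: lookup_sum lookup_single when_def)

text \<open>
  The ideal generated by monomials is spanned by the monomials that some generator divides, and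
  a squarefree monomial divides another monomial iff its support is contained in the support of
  that monomial.
\<close>
lemma squarefree_monomial_ideal:
  fixes \<G> :: "'v::finite set set"
  shows "Idl\<^bsub>mpoly_ring\<^esub> {\<Prod>i\<in>G. var i | G. G \<in> \<G>}
    = {p :: ('v, 'k::field) mpoly. Poly_Mapping.keys p \<subseteq> {m. \<exists>G\<in>\<G>. G \<subseteq> Poly_Mapping.keys m}}"
    (is "?I = ?J")
proof
  let ?R = "mpoly_ring :: ('v, 'k) mpoly ring"
  interpret ring ?R by (rule ring_from_type_algebra)
  show "?I \<subseteq> ?J"
  proof (rule genideal_minimal)
    show "ideal ?J ?R"
      by (rule monomial_ideal_upclosed) (auto simp: keys_add_nat)
    show "{\<Prod>i\<in>G. var i | G. G \<in> \<G>} \<subseteq> ?J"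
    proof safe
      fix G m assume "G \<in> \<G>" "m \<in> Poly_Mapping.keys (\<Prod>i\<in>G. var i :: ('v, 'k) mpoly)"
      then show "\<exists>G\<in>\<G>. G \<subseteq> Poly_Mapping.keys m"
        by (intro bexI[of _ G]) (auto simp: prod_var in_keys_iff lookup_sum_single simp del: One_nat_def)
    qed
  qed
  have idl: "ideal ?I ?R" by (rule genideal_ideal) auto
  show "?J \<subseteq> ?I"
  proof
    fix p assume p: "p \<in> ?J"
    have "Poly_Mapping.single m c \<in> ?I" if m: "m \<in> Poly_Mapping.keys p" for m c
    proof -
      obtain G where G: "G \<in> \<G>" "G \<subseteq> Poly_Mapping.keys m" using p m by blast
      let ?e = "\<Sum>i\<in>G. Poly_Mapping.single i (1::nat)"
      have "m = (m - ?e) + ?e"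
        using G(2) by (intro poly_mapping_eqI)
          (auto simp: lookup_add lookup_minus lookup_sum_single in_keys_iff subset_iff Suc_le_eq simp del: One_nat_def)
      then have "Poly_Mapping.single m c = Poly_Mapping.single (m - ?e) c * (\<Prod>i\<in>G. var i)"
        by (simp add: prod_var mult_single)
      moreover have "(\<Prod>i\<in>G. var i) \<in> ?I"
        using genideal_self[of "{\<Prod>i\<in>G. var i | G. G \<in> \<G>}"] G(1) by auto
      ultimately show ?thesis using ideal_type_algebraD(3)[OF idl] by auto
    qed
    then have "(\<Sum>m\<in>Poly_Mapping.keys p. Poly_Mapping.single m (Poly_Mapping.lookup p m)) \<in> ?I"
      by (intro ideal_sum_type_algebra[OF idl]) auto
    then show "p \<in> ?I" by (simp add: poly_mapping_sum_single)
  qed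
qed

section \<open>The Hilbert function\<close>

abbreviation face_monomials :: "'v::finite set set \<Rightarrow> nat \<Rightarrow> ('v \<Rightarrow>\<^sub>0 nat) set" where
  "face_monomials \<Delta> d \<equiv>
     {m. Poly_Mapping.keys m \<in> \<Delta> \<and> (\<Sum>v\<in>UNIV. Poly_Mapping.lookup m v) = d}"

lemma one_notin_stanley_reisner:
  assumes "simplicial_complex \<Delta>"
  shows "1 \<notin> (stanley_reisner_ideal \<Delta> :: ('v, 'k::field) mpoly set)"
  using assms by (auto simp: stanley_reisner_ideal_def simplicial_complex_def)

lemma subfield_quot_scalars:
  fixes I :: "('v::finite, 'k::field) mpoly set"
  assumes I: "ideal I mpoly_ring" and "1 \<notin> I"
  shows "subfield (quot_scalars I) (mpoly_ring Quot I)"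
proof -
  let ?K = "ring_of_type_algebra :: 'k ring"
  let ?h = "\<lambda>c. I +>\<^bsub>mpoly_ring\<^esub> const c"
  interpret K: field ?K by (rule field_from_type_algebra)
  interpret Q: ring "mpoly_ring Quot I" using I by (rule ideal.quotient_is_ring)
  note Q = quot_type_algebra[OF I]
  interpret h: ring_hom_ring ?K "mpoly_ring Quot I" ?h
    by unfold_locales
      (auto simp: ring_hom_def Q const_def mult_single single_add)
  have "\<one>\<^bsub>mpoly_ring Quot I\<^esub> \<noteq> \<zero>\<^bsub>mpoly_ring Quot I\<^esub>"
    using assms(2) by (simp add: Q)
  from h.img_is_subfield(2)[OF K.carrier_is_subfield this]
  show ?thesis by (simp add: quot_scalars_def)
qed

text \<open>
  This description of spans turns linear independence of residue classes of monomials into a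
  statement about single monomials, so that bases can be handled one list entry at a time.
\<close>
lemma Span_monomials:
  fixes I :: "('v::finite, 'k::field) mpoly set"
  assumes I: "ideal I mpoly_ring"
  shows "ring.Span (mpoly_ring Quot I) (quot_scalars I)
      (map (\<lambda>m. I +>\<^bsub>mpoly_ring\<^esub> Poly_Mapping.single m 1) ms)
    = (\<lambda>p. I +>\<^bsub>mpoly_ring\<^esub> p) ` {p. Poly_Mapping.keys p \<subseteq> set ms}"
proof -
  interpret Q: ring "mpoly_ring Quot I" using I by (rule ideal.quotient_is_ring)
  note Q = quot_type_algebra[OF I]
  show ?thesis
  proof (induction ms)
    case Nil
    have "{p :: ('v, 'k) mpoly. Poly_Mapping.keys p = {}} = {0}" by auto
    then show ?case by (simp add: Q)
  next
    case (Cons m ms)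
    let ?h = "\<lambda>p. I +>\<^bsub>mpoly_ring\<^esub> p"
    have split: "\<exists>c q. Poly_Mapping.keys q \<subseteq> set ms \<and> p = const c * Poly_Mapping.single m 1 + q"
      if p: "Poly_Mapping.keys p \<subseteq> set (m # ms)" for p :: "('v, 'k) mpoly"
    proof (intro exI conjI)
      let ?q = "p - Poly_Mapping.single m (Poly_Mapping.lookup p m)"
      show "Poly_Mapping.keys ?q \<subseteq> set ms"
        using p by (auto simp: in_keys_iff lookup_minus lookup_single when_def subset_iff split: if_splits)
      show "p = const (Poly_Mapping.lookup p m) * Poly_Mapping.single m 1 + ?q"
        by (simp add: const_def mult_single)
    qed
    have join: "Poly_Mapping.keys (const c * Poly_Mapping.single m 1 + q) \<subseteq> set (m # ms)"
      if "Poly_Mapping.keys q \<subseteq> set ms" for c and q :: "('v, 'k) mpoly"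
      using that keys_add[of "Poly_Mapping.single m c" q]
      by (auto simp: const_def mult_single split: if_splits)
    have "Q.Span (quot_scalars I) (map (\<lambda>m. ?h (Poly_Mapping.single m 1)) (m # ms))
      = Q.line_extension (quot_scalars I) (?h (Poly_Mapping.single m 1))
         (Q.Span (quot_scalars I) (map (\<lambda>m. ?h (Poly_Mapping.single m 1)) ms))"
      by simp
    also have "\<dots> = {?h (const c * Poly_Mapping.single m 1 + q) |c q. Poly_Mapping.keys q \<subseteq> set ms}"
    proof -
      have "x \<in> Q.line_extension (range (\<lambda>c. ?h (const c))) (?h (Poly_Mapping.single m 1))
             (?h ` {p. Poly_Mapping.keys p \<subseteq> set ms})
          \<longleftrightarrow> (\<exists>c q. Poly_Mapping.keys q \<subseteq> set ms \<and>
             x = ?h (const c) \<otimes>\<^bsub>mpoly_ring Quot I\<^esub> ?h (Poly_Mapping.single m 1)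
                 \<oplus>\<^bsub>mpoly_ring Quot I\<^esub> ?h q)" for x
        unfolding Q.line_extension_mem_iff by blast
      then show ?thesis
        unfolding Cons.IH unfolding quot_scalars_def Q(2,3) by blast
    qed
    also have "\<dots> = ?h ` {p. Poly_Mapping.keys p \<subseteq> set (m # ms)}"
    proof (intro equalityI subsetI)
      fix x assume "x \<in> {?h (const c * Poly_Mapping.single m 1 + q) |c q. Poly_Mapping.keys q \<subseteq> set ms}"
      then show "x \<in> ?h ` {p. Poly_Mapping.keys p \<subseteq> set (m # ms)}" using join by blast
    next
      fix x assume "x \<in> ?h ` {p. Poly_Mapping.keys p \<subseteq> set (m # ms)}"
      then obtain p where "x = ?h p" "Poly_Mapping.keys p \<subseteq> set (m # ms)" by blast
      with split[of p] show "x \<in> {?h (const c * Poly_Mapping.single m 1 + q) |c q. Poly_Mapping.keys q \<subseteq> set ms}"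
        by blast
    qed
    finally show ?case .
  qed
qed

lemma independent_monomials:
  fixes ms :: "('v::finite \<Rightarrow>\<^sub>0 nat) list"
  assumes \<Delta>: "simplicial_complex \<Delta>"
    and "distinct ms" "\<And>m. m \<in> set ms \<Longrightarrow> Poly_Mapping.keys m \<in> \<Delta>"
  defines "I \<equiv> (stanley_reisner_ideal \<Delta> :: ('v, 'k::field) mpoly set)"
  shows "ring.independent (mpoly_ring Quot I) (quot_scalars I)
      (map (\<lambda>m. I +>\<^bsub>mpoly_ring\<^esub> Poly_Mapping.single m 1) ms)"
proof -
  have I: "ideal I mpoly_ring" unfolding I_def using \<Delta> by (rule ideal_stanley_reisner)
  interpret Q: ring "mpoly_ring Quot I" using I by (rule ideal.quotient_is_ring)
  note Q = quot_type_algebra[OF I]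
  show ?thesis using assms(2,3)
  proof (induction ms)
    case (Cons m ms)
    have notin: "I +>\<^bsub>mpoly_ring\<^esub> Poly_Mapping.single m 1 \<noteq> I +>\<^bsub>mpoly_ring\<^esub> p"
      if p: "Poly_Mapping.keys p \<subseteq> set ms" for p
    proof
      assume "I +>\<^bsub>mpoly_ring\<^esub> Poly_Mapping.single m 1 = I +>\<^bsub>mpoly_ring\<^esub> p"
      then have "Poly_Mapping.single m 1 - p \<in> I" by (simp add: Q)
      moreover have "m \<in> Poly_Mapping.keys (Poly_Mapping.single m 1 - p)"
        using p Cons.prems(1) by (auto simp: in_keys_iff lookup_minus subset_iff)
      ultimately have "Poly_Mapping.keys m \<notin> \<Delta>" by (auto simp: I_def stanley_reisner_ideal_def)
      then show False using Cons.prems(2) by simp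
    qed
    have "Q.independent (quot_scalars I)
        ((I +>\<^bsub>mpoly_ring\<^esub> Poly_Mapping.single m 1) #
          map (\<lambda>m. I +>\<^bsub>mpoly_ring\<^esub> Poly_Mapping.single m 1) ms)"
    proof (rule Q.li_Cons)
      show "I +>\<^bsub>mpoly_ring\<^esub> Poly_Mapping.single m 1 \<in> carrier (mpoly_ring Quot I)"
        unfolding Q(1) by (rule rangeI)
      show "I +>\<^bsub>mpoly_ring\<^esub> Poly_Mapping.single m 1 \<notin> Q.Span (quot_scalars I)
          (map (\<lambda>m. I +>\<^bsub>mpoly_ring\<^esub> Poly_Mapping.single m 1) ms)"
        unfolding Span_monomials[OF I] using notin by blast
    qed (use Cons in simp)
    then show ?case by simp
  qed simp
qed

lemma finite_face_monomials: "finite (face_monomials \<Delta> d)"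
proof (rule finite_subset)
  have le: "Poly_Mapping.lookup m v \<le> d" if "(\<Sum>v\<in>UNIV. Poly_Mapping.lookup m v) = d"
    for m :: "'a \<Rightarrow>\<^sub>0 nat" and v
    using that member_le_sum[of v UNIV "Poly_Mapping.lookup m"] by simp
  show "face_monomials \<Delta> d \<subseteq> Poly_Mapping.lookup -` (PiE UNIV (\<lambda>_. {..d}))"
    using le by (auto simp: PiE_UNIV_domain)
  show "finite (Poly_Mapping.lookup -` (PiE (UNIV :: 'a set) (\<lambda>_. {..d})))"
  proof (rule finite_vimageI)
    show "finite (PiE (UNIV :: 'a set) (\<lambda>_. {..d}))" by (rule finite_PiE) auto
    show "inj (Poly_Mapping.lookup :: ('a \<Rightarrow>\<^sub>0 nat) \<Rightarrow> 'a \<Rightarrow> nat)"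
      by (rule injI) (rule poly_mapping_eq_iff[THEN iffD2])
  qed
qed

text \<open>
  Deleting from a form its monomials supported on nonfaces does not change its residue class, so
  the monomials supported on faces span; they are independent because no combination of them
  lies in the ideal.
\<close>
lemma hilbert_function_stanley_reisner:
  assumes \<Delta>: "simplicial_complex \<Delta>"
  shows "hilbert_function (stanley_reisner_ideal \<Delta> :: ('v::finite, 'k::field) mpoly set) d
    = card (face_monomials \<Delta> d)"
proof -
  define I where "I = (stanley_reisner_ideal \<Delta> :: ('v, 'k) mpoly set)"
  have I: "ideal I mpoly_ring" unfolding I_def using \<Delta> by (rule ideal_stanley_reisner)
  interpret Q: ring "mpoly_ring Quot I" using I by (rule ideal.quotient_is_ring)
  note Q = quot_type_algebra[OF I]
  let ?h = "\<lambda>p. I +>\<^bsub>mpoly_ring\<^esub> p"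
  obtain ms where ms: "set ms = face_monomials \<Delta> d" "distinct ms"
    using finite_distinct_list[OF finite_face_monomials] by blast
  let ?Us = "map (\<lambda>m. ?h (Poly_Mapping.single m 1)) ms"
  have "Q.Span (quot_scalars I) ?Us = quot_component I d"
    unfolding Span_monomials[OF I] quot_component_def
  proof (intro equalityI subsetI)
    fix x assume "x \<in> ?h ` {p. Poly_Mapping.keys p \<subseteq> set ms}"
    then show "x \<in> ?h ` homogeneous_component d"
      by (auto simp: ms homogeneous_component_def)
  next
    fix x assume "x \<in> ?h ` homogeneous_component d"
    then obtain p where p: "x = ?h p" "p \<in> homogeneous_component d" by auto
    \<comment> \<open>the part of \<open>p\<close> supported on faces\<close>
    define q where "q = (\<Sum>m\<in>Poly_Mapping.keys p \<inter> {m. Poly_Mapping.keys m \<in> \<Delta>}.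
      Poly_Mapping.single m (Poly_Mapping.lookup p m))"
    have q: "Poly_Mapping.lookup q m = (if Poly_Mapping.keys m \<in> \<Delta> then Poly_Mapping.lookup p m else 0)" for m
      by (auto simp: q_def lookup_sum lookup_single when_def in_keys_iff)
    have "p - q \<in> I" by (auto simp: I_def stanley_reisner_ideal_def in_keys_iff lookup_minus q)
    moreover have "Poly_Mapping.keys q \<subseteq> set ms"
      using p(2) by (auto simp: ms homogeneous_component_def in_keys_iff q split: if_splits)
    ultimately show "x \<in> ?h ` {p. Poly_Mapping.keys p \<subseteq> set ms}"
      using p(1) by (auto simp: Q image_iff intro!: exI[of _ q])
  qed
  moreover have "Q.independent (quot_scalars I) ?Us"
    unfolding I_def by (rule independent_monomials[OF \<Delta> ms(2)]) (use ms(1) in auto)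
  ultimately have "Q.dimension (length ms) (quot_scalars I) (quot_component I d)"
    using Q.dimension_independent[of "quot_scalars I" ?Us] by (simp del: Q.Span.simps)
  moreover have "subfield (quot_scalars I) (mpoly_ring Quot I)"
    using I one_notin_stanley_reisner[OF \<Delta>] by (intro subfield_quot_scalars) (auto simp: I_def)
  ultimately have "hilbert_function I d = length ms"
    using Q.dimI[of "quot_scalars I" "length ms"] unfolding hilbert_function_def over_def by blast
  then show ?thesis using distinct_card[OF ms(2)] by (simp add: I_def ms(1))
qed

section \<open>The Hilbert series\<close>

text \<open>
  Dividing a monomial with support \<open>S\<close> by a variable \<open>v \<in> S\<close> either keeps the support
  or removes \<open>v\<close> from it.
\<close>
lemma card_monomials_support_Suc:
  fixes S :: "'v::finite set"
  assumes v: "v \<in> S"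
  shows "card {m :: 'v \<Rightarrow>\<^sub>0 nat. Poly_Mapping.keys m = S \<and> (\<Sum>v\<in>UNIV. Poly_Mapping.lookup m v) = Suc d}
    = card {m :: 'v \<Rightarrow>\<^sub>0 nat. Poly_Mapping.keys m = S \<and> (\<Sum>v\<in>UNIV. Poly_Mapping.lookup m v) = d}
      + card {m :: 'v \<Rightarrow>\<^sub>0 nat. Poly_Mapping.keys m = S - {v} \<and> (\<Sum>v\<in>UNIV. Poly_Mapping.lookup m v) = d}"
    (is "card ?A = card ?B + card ?C")
proof -
  let ?f = "\<lambda>m :: 'v \<Rightarrow>\<^sub>0 nat. m + Poly_Mapping.single v 1"
  have deg: "(\<Sum>u\<in>UNIV. Poly_Mapping.lookup (?f m) u) = Suc (\<Sum>u\<in>UNIV. Poly_Mapping.lookup m u)" for m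
    by (simp add: lookup_add sum.distrib lookup_single when_def)
  have "bij_betw ?f (?B \<union> ?C) ?A"
  proof (rule bij_betwI')
    fix m assume "m \<in> ?B \<union> ?C"
    then show "?f m \<in> ?A" using v by (auto simp: deg[simplified] keys_add_nat)
  next
    fix m assume m: "m \<in> ?A"
    let ?n = "m - Poly_Mapping.single v 1"
    have m': "m = ?f ?n"
      using m v by (intro poly_mapping_eqI)
        (auto simp: lookup_add lookup_minus lookup_single when_def in_keys_iff)
    have "(\<Sum>u\<in>UNIV. Poly_Mapping.lookup ?n u) = d"
      using m deg[of ?n] m' by simp
    moreover have "Poly_Mapping.keys ?n = S \<or> Poly_Mapping.keys ?n = S - {v}"
      using m by (auto simp: in_keys_iff lookup_minus lookup_single when_def split: if_splits)
    ultimately show "\<exists>n\<in>?B \<union> ?C. m = ?f n" using m' by blast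
  qed simp
  then have "card ?A = card (?B \<union> ?C)" by (simp add: bij_betw_same_card)
  also have "\<dots> = card ?B + card ?C"
  proof (rule card_Un_disjoint)
    show "finite ?B" "finite ?C"
      by (rule finite_subset[OF _ finite_face_monomials[of UNIV d]]; auto)+
  qed (use v in auto)
  finally show ?thesis .
qed

text \<open>
  The monomials with support \<open>S\<close> contribute \<open>(t / (1 - t)) ^ card S\<close> to the Hilbert
  series. Induction on \<open>S\<close>: the recursion for the counts says that adding a vertex
  multiplies the series by \<open>t / (1 - t)\<close>.
\<close>
lemma support_series:
  fixes S :: "'v::finite set"
  shows "Abs_fps (\<lambda>d. int (card {m :: 'v \<Rightarrow>\<^sub>0 nat. Poly_Mapping.keys m = S
        \<and> (\<Sum>v\<in>UNIV. Poly_Mapping.lookup m v) = d})) * (1 - fps_X) ^ card S = fps_X ^ card S"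
    (is "?C S * _ = _")
proof (induction S rule: finite_induct[OF finite])
  case 1
  have "{m :: 'v \<Rightarrow>\<^sub>0 nat. Poly_Mapping.keys m = {} \<and> (\<Sum>v\<in>UNIV. Poly_Mapping.lookup m v) = d}
      = (if d = 0 then {0} else {})" for d by auto
  then show ?case by (auto simp: fps_eq_iff)
next
  case (2 v S)
  have "?C (insert v S) * (1 - fps_X) = fps_X * ?C S"
  proof (rule fps_ext)
    fix n
    show "(?C (insert v S) * (1 - fps_X)) $ n = (fps_X * ?C S) $ n"
    proof (cases n)
      case 0
      have "\<not> (Poly_Mapping.keys m = insert v S \<and> (\<Sum>v\<in>UNIV. Poly_Mapping.lookup m v) = 0)"
        for m :: "'v \<Rightarrow>\<^sub>0 nat"
        by (metis finite_class.finite_UNIV in_keys_iff insertI1 sum_eq_0_iff UNIV_I)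
      then have "{m :: 'v \<Rightarrow>\<^sub>0 nat. Poly_Mapping.keys m = insert v S
          \<and> (\<Sum>v\<in>UNIV. Poly_Mapping.lookup m v) = 0} = {}" by blast
      then have "card {m :: 'v \<Rightarrow>\<^sub>0 nat. Poly_Mapping.keys m = insert v S
          \<and> (\<Sum>v\<in>UNIV. Poly_Mapping.lookup m v) = 0} = 0" by (simp only: card.empty)
      then show ?thesis using 0 by (simp add: algebra_simps)
    next
      case (Suc d)
      show ?thesis
        using card_monomials_support_Suc[of v "insert v S" d] 2(2)
        by (simp add: Suc algebra_simps)
    qed
  qed
  then have "?C (insert v S) * (1 - fps_X) * (1 - fps_X) ^ card S = fps_X * (?C S * (1 - fps_X) ^ card S)"
    by (simp add: mult.assoc)
  then show ?case using 2 by (simp add: mult.assoc)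
qed

lemma hilbert_series_stanley_reisner:
  fixes \<Delta> :: "'v::finite set set"
  assumes \<Delta>: "simplicial_complex \<Delta>" and D: "\<And>S. S \<in> \<Delta> \<Longrightarrow> card S \<le> D"
  shows "hilbert_series (stanley_reisner_ideal \<Delta> :: ('v, 'k::field) mpoly set) * (1 - fps_X) ^ D
    = (\<Sum>S\<in>\<Delta>. fps_X ^ card S * (1 - fps_X) ^ (D - card S))"
proof -
  let ?A = "\<lambda>d S. {m :: 'v \<Rightarrow>\<^sub>0 nat. Poly_Mapping.keys m = S \<and> (\<Sum>v\<in>UNIV. Poly_Mapping.lookup m v) = d}"
  have "card (face_monomials \<Delta> d) = (\<Sum>S\<in>\<Delta>. card (?A d S))" for d
  proof -
    have "face_monomials \<Delta> d = (\<Union>S\<in>\<Delta>. ?A d S)" by auto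
    also have "card \<dots> = (\<Sum>S\<in>\<Delta>. card (?A d S))"
      by (rule card_UN_disjoint)
        (auto intro: finite_subset[OF _ finite_face_monomials[of UNIV d]])
    finally show ?thesis .
  qed
  then have "hilbert_series (stanley_reisner_ideal \<Delta> :: ('v, 'k) mpoly set)
      = (\<Sum>S\<in>\<Delta>. Abs_fps (\<lambda>d. int (card (?A d S))))"
    by (simp add: hilbert_series_def hilbert_function_stanley_reisner[OF \<Delta>] fps_eq_iff fps_sum_nth)
  also have "\<dots> * (1 - fps_X) ^ D
      = (\<Sum>S\<in>\<Delta>. Abs_fps (\<lambda>d. int (card (?A d S))) * (1 - fps_X) ^ card S * (1 - fps_X) ^ (D - card S))"
    using D by (simp add: sum_distrib_right mult.assoc flip: power_add)
  finally show ?thesis by (simp only: support_series)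
qed

section \<open>Upper bound for the Krull dimension\<close>

text \<open>
  Gaussian elimination: each equation either is void or serves to eliminate one unknown, and a
  solution of the reduced system extends to the eliminated unknown.
\<close>
lemma linear_dependence:
  fixes f :: "'i \<Rightarrow> 'b \<Rightarrow> 'k::field"
  assumes "finite B" "finite A" "card B < card A"
  shows "\<exists>c. (\<exists>a\<in>A. c a \<noteq> 0) \<and> (\<forall>b\<in>B. (\<Sum>a\<in>A. c a * f a b) = 0)"
  using assms
proof (induction B arbitrary: A f rule: finite_induct)
  case empty
  then have "A \<noteq> {}" by auto
  then show ?case by (intro exI[of _ "\<lambda>_. 1"]) auto
next
  case (insert b B)
  show ?case
  proof (cases "\<forall>a\<in>A. f a b = 0")
    case True
    have "card B < card A" using insert by simp
    from insert.IH[OF insert.prems(1) this] obtain c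
      where "\<exists>a\<in>A. c a \<noteq> 0" "\<forall>b\<in>B. (\<Sum>a\<in>A. c a * f a b) = 0" by blast
    with True show ?thesis by (intro exI[of _ c]) auto
  next
    case False
    then obtain a0 where a0: "a0 \<in> A" "f a0 b \<noteq> 0" by auto
    \<comment> \<open>the unknown \<open>a0\<close> is eliminated using the equation \<open>b\<close>\<close>
    define g where "g a x = f a x - f a b / f a0 b * f a0 x" for a x
    have "card B < card (A - {a0})" using insert a0 by simp
    from insert.IH[OF _ this, of g] insert.prems(1) obtain c
      where c: "\<exists>a\<in>A - {a0}. c a \<noteq> 0" "\<forall>x\<in>B. (\<Sum>a\<in>A - {a0}. c a * g a x) = 0" by auto
    let ?c = "\<lambda>a. if a = a0 then - (\<Sum>a\<in>A - {a0}. c a * (f a b / f a0 b)) else c a"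
    have "(\<Sum>a\<in>A. ?c a * f a x) = (\<Sum>a\<in>A - {a0}. c a * g a x)" for x
    proof -
      have "(\<Sum>a\<in>A. ?c a * f a x) = ?c a0 * f a0 x + (\<Sum>a\<in>A - {a0}. ?c a * f a x)"
        using insert.prems(1) a0(1) by (rule sum.remove)
      also have "(\<Sum>a\<in>A - {a0}. ?c a * f a x) = (\<Sum>a\<in>A - {a0}. c a * f a x)"
        by (rule sum.cong) auto
      finally show ?thesis
        by (simp add: g_def right_diff_distrib sum_subtractf sum_distrib_right mult.assoc)
    qed
    moreover have "g a b = 0" for a using a0(2) by (simp add: g_def)
    ultimately show ?thesis using c by (intro exI[of _ ?c]) auto
  qed
qed

text \<open>
  Descent along the chain. Suppose that the sum lies in \<open>P 0\<close>, and let \<open>k\<close> be the least exponent of \<open>y 0\<close> in the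
  relation. As \<open>y 0 \<notin> P 0\<close>, the power \<open>y 0 ^ k\<close> can be cancelled modulo
  \<open>P 0\<close>; as \<open>y 0 \<in> P 1\<close>, the remaining terms that still contain \<open>y 0\<close> vanish
  modulo \<open>P 1\<close>. What remains is a shorter relation for the chain starting at \<open>P 1\<close>,
  and a relation of length zero would put a unit into a prime ideal.
\<close>
lemma prime_chain_no_relation:
  fixes P :: "nat \<Rightarrow> 'a::comm_ring_1 set"
  assumes "\<And>i. i \<le> n \<Longrightarrow> primeideal (P i) (ring_of_type_algebra :: 'a ring)"
    and "\<And>i. i < n \<Longrightarrow> P i \<subseteq> P (Suc i)"
    and "\<And>i. i < n \<Longrightarrow> y i \<in> P (Suc i) - P i"
    and "finite A" "A \<noteq> {}" "\<And>a. a \<in> A \<Longrightarrow> length a = n" "\<And>a. a \<in> A \<Longrightarrow> c a dvd 1"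
  shows "(\<Sum>a\<in>A. c a * (\<Prod>i<n. y i ^ (a ! i))) \<notin> P 0"
  using assms
proof (induction n arbitrary: P y A c)
  case 0
  then have A: "A = {[]}" by fastforce
  then obtain d where "d * c [] = 1" using "0.prems"(7)[of "[]"] by (auto simp: dvd_def mult.commute)
  then have "c [] \<notin> P 0"
    using primeideal_type_algebraD(1,2)[OF "0.prems"(1)] ideal_type_algebraD(3) by (metis le0)
  then show ?case by (simp add: A)
next
  case (Suc n)
  note P = primeideal_type_algebraD[OF Suc.prems(1)]
  define k where "k = Min (hd ` A)"
  define B where "B = {a \<in> A. hd a = k}"
  have "k \<in> hd ` A" unfolding k_def using Suc.prems(4,5) by (intro Min_in) auto
  then have "B \<noteq> {}" by (auto simp: B_def)
  have k_le: "k \<le> hd a" if "a \<in> A" for a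
    unfolding k_def using Suc.prems(4) that by (intro Min_le) auto
  have Cons: "a = hd a # tl a" "length (tl a) = n" if "a \<in> A" for a
    using Suc.prems(6)[OF that] by (cases a; simp)+
  define t where "t a = c a * (\<Prod>i<n. y (Suc i) ^ (tl a ! i))" for a
  have summand: "c a * (\<Prod>i<Suc n. y i ^ (a ! i)) = y 0 ^ k * (y 0 ^ (hd a - k) * t a)" if "a \<in> A" for a
  proof -
    have "(\<Prod>i<Suc n. y i ^ (a ! i)) = y 0 ^ hd a * (\<Prod>i<n. y (Suc i) ^ (tl a ! i))"
      by (subst Cons(1)[OF that], subst prod.lessThan_Suc_shift) simp
    also have "y 0 ^ hd a = y 0 ^ k * y 0 ^ (hd a - k)"
      using k_le[OF that] by (simp flip: power_add)
    finally show ?thesis by (simp add: t_def mult_ac)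
  qed
  show ?case
  proof
    assume "(\<Sum>a\<in>A. c a * (\<Prod>i<Suc n. y i ^ (a ! i))) \<in> P 0"
    moreover have "(\<Sum>a\<in>A. c a * (\<Prod>i<Suc n. y i ^ (a ! i)))
      = y 0 ^ k * (\<Sum>a\<in>A. y 0 ^ (hd a - k) * t a)"
      unfolding sum_distrib_left by (rule sum.cong) (simp_all only: summand)
    ultimately have "y 0 ^ k * (\<Sum>a\<in>A. y 0 ^ (hd a - k) * t a) \<in> P 0" by simp
    moreover have "y 0 ^ k \<notin> P 0" using P(4)[OF le0] Suc.prems(3)[of 0] by blast
    ultimately have "(\<Sum>a\<in>A. y 0 ^ (hd a - k) * t a) \<in> P 0" using P(3)[OF le0] by blast
    then have in1: "(\<Sum>a\<in>A. y 0 ^ (hd a - k) * t a) \<in> P 1" using Suc.prems(2)[of 0] by auto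
    have I1: "ideal (P 1) (ring_of_type_algebra :: 'a ring)" using P(1)[of 1] by simp
    have "y 0 ^ (hd a - k) * t a \<in> P 1" if "a \<in> A - B" for a
    proof -
      have "hd a - k = Suc (hd a - k - 1)" using that k_le[of a] by (auto simp: B_def)
      then have "y 0 ^ (hd a - k) * t a = (y 0 ^ (hd a - k - 1) * t a) * y 0"
        by (metis power_Suc mult.commute mult.assoc)
      then show ?thesis using ideal_type_algebraD(3)[OF I1] Suc.prems(3)[of 0] by simp
    qed
    then have "(\<Sum>a\<in>A - B. y 0 ^ (hd a - k) * t a) \<in> P 1"
      by (intro ideal_sum_type_algebra[OF I1])
    moreover have "(\<Sum>a\<in>A. y 0 ^ (hd a - k) * t a)
      = (\<Sum>a\<in>A - B. y 0 ^ (hd a - k) * t a) + (\<Sum>a\<in>B. y 0 ^ (hd a - k) * t a)"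
      using Suc.prems(4) by (intro sum.subset_diff) (auto simp: B_def)
    moreover have "(\<Sum>a\<in>B. y 0 ^ (hd a - k) * t a) = (\<Sum>a\<in>B. t a)"
      by (rule sum.cong) (auto simp: B_def)
    ultimately have "(\<Sum>a\<in>B. t a) \<in> P 1"
      using ideal_type_algebraD(4)[OF I1 in1] by fastforce
    moreover have "(\<Sum>a\<in>B. t a) = (\<Sum>a\<in>tl ` B. c (k # a) * (\<Prod>i<n. y (Suc i) ^ (a ! i)))"
    proof (subst sum.reindex)
      show "inj_on tl B" using Cons(1) by (intro inj_onI) (metis (mono_tags, lifting) B_def mem_Collect_eq)
      show "(\<Sum>a\<in>B. t a) = (\<Sum>a\<in>B. ((\<lambda>a. c (k # a) * (\<Prod>i<n. y (Suc i) ^ (a ! i))) \<circ> tl) a)"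
      proof (rule sum.cong)
        fix a assume "a \<in> B"
        then have "k # tl a = a" using Cons(1)[of a] by (simp add: B_def)
        then show "t a = ((\<lambda>a. c (k # a) * (\<Prod>i<n. y (Suc i) ^ (a ! i))) \<circ> tl) a"
          by (simp add: t_def)
      qed simp
    qed
    ultimately have "(\<Sum>a\<in>tl ` B. c (k # a) * (\<Prod>i<n. y (Suc i) ^ (a ! i))) \<in> P (Suc 0)" by simp
    moreover have "(\<Sum>a\<in>tl ` B. c (k # a) * (\<Prod>i<n. y (Suc i) ^ (a ! i))) \<notin> P (Suc 0)"
    proof (rule Suc.IH[of "\<lambda>i. P (Suc i)" "\<lambda>i. y (Suc i)" "tl ` B" "\<lambda>a. c (k # a)"])
      show "c (k # a) dvd 1" if a: "a \<in> tl ` B" for a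
      proof -
        obtain b where b: "b \<in> B" "a = tl b" using a by auto
        then have "k # a = b" using Cons(1)[of b] by (simp add: B_def)
        then show ?thesis using b(1) Suc.prems(7)[of b] by (simp add: B_def)
      qed
      show "length a = n" if "a \<in> tl ` B" for a using that Cons(2) by (auto simp: B_def)
      show "finite (tl ` B)" "tl ` B \<noteq> {}" using Suc.prems(4) \<open>B \<noteq> {}\<close> by (auto simp: B_def)
    qed (use Suc.prems(1-3) in auto)
    ultimately show False by blast
  qed
qed

text \<open>
  Bounding all exponents separately, instead of the total degree, makes the monomials to be
  counted into the points of boxes.
\<close>
definition exponents_le :: "nat \<Rightarrow> ('v, 'k::field) mpoly \<Rightarrow> bool" where
  "exponents_le t p \<longleftrightarrow> (\<forall>m\<in>Poly_Mapping.keys p. \<forall>v. Poly_Mapping.lookup m v \<le> t)"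

lemma exponents_le_mult:
  assumes "exponents_le s p" "exponents_le t q"
  shows "exponents_le (s + t) (p * q)"
  unfolding exponents_le_def
proof (intro ballI allI)
  fix m v assume "m \<in> Poly_Mapping.keys (p * q)"
  then obtain a b where "m = a + b" "a \<in> Poly_Mapping.keys p" "b \<in> Poly_Mapping.keys q"
    using keys_mult[of p q] by blast
  with assms show "Poly_Mapping.lookup m v \<le> s + t"
    by (auto simp: exponents_le_def lookup_add intro: add_mono)
qed

lemma exponents_le_1: "exponents_le t 1"
  by (simp add: exponents_le_def)

lemma exponents_le_power: "exponents_le t p \<Longrightarrow> exponents_le (n * t) (p ^ n)"
  by (induction n) (auto simp: exponents_le_1 exponents_le_mult)

lemma exponents_le_prod:
  "(\<And>i. i < n \<Longrightarrow> exponents_le t (f i)) \<Longrightarrow> exponents_le (n * t) (\<Prod>i<n. f i)"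
proof (induction n)
  case (Suc n)
  then have "exponents_le (n * t + t) ((\<Prod>i<n. f i) * f n)" by (intro exponents_le_mult) auto
  then show ?case by (simp add: add.commute)
qed (simp add: exponents_le_1)

lemma exponents_le_mono: "exponents_le s p \<Longrightarrow> s \<le> t \<Longrightarrow> exponents_le t p"
  by (auto simp: exponents_le_def intro: order.trans)

lemma exponents_le_exists:
  fixes y :: "nat \<Rightarrow> ('v::finite, 'k::field) mpoly"
  shows "\<exists>t. \<forall>i<n. exponents_le t (y i)"
proof -
  have "finite (\<Union>i<n. \<Union>m\<in>Poly_Mapping.keys (y i). range (Poly_Mapping.lookup m))" by simp
  then obtain t where "\<forall>x\<in>(\<Union>i<n. \<Union>m\<in>Poly_Mapping.keys (y i). range (Poly_Mapping.lookup m)). x \<le> t"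
    using finite_nat_set_iff_bounded_le by auto
  then show ?thesis by (intro exI[of _ t]) (auto simp: exponents_le_def)
qed

lemma card_bounded_face_monomials:
  fixes \<Delta> :: "'v::finite set set"
  assumes "\<And>S. S \<in> \<Delta> \<Longrightarrow> card S \<le> D"
  shows "finite {m. Poly_Mapping.keys m \<in> \<Delta> \<and> (\<forall>v. Poly_Mapping.lookup m v \<le> t)}" (is "finite ?B")
    and "card {m. Poly_Mapping.keys m \<in> \<Delta> \<and> (\<forall>v. Poly_Mapping.lookup m v \<le> t)} \<le> card \<Delta> * (t + 1) ^ D"
proof -
  let ?A = "\<lambda>S. {m :: 'v \<Rightarrow>\<^sub>0 nat. Poly_Mapping.keys m = S \<and> (\<forall>v. Poly_Mapping.lookup m v \<le> t)}"
  have A: "finite (?A S) \<and> card (?A S) \<le> (t + 1) ^ card S" for S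
  proof -
    let ?f = "\<lambda>m. restrict (Poly_Mapping.lookup m) S"
    have inj: "inj_on ?f (?A S)"
    proof (rule inj_onI, rule poly_mapping_eqI)
      fix m n v assume m: "m \<in> ?A S" and n: "n \<in> ?A S" and eq: "?f m = ?f n"
      show "Poly_Mapping.lookup m v = Poly_Mapping.lookup n v"
      proof (cases "v \<in> S")
        case True then show ?thesis using fun_cong[OF eq, of v] by simp
      next
        case False
        then have "v \<notin> Poly_Mapping.keys m" "v \<notin> Poly_Mapping.keys n" using m n by auto
        then show ?thesis by (simp add: in_keys_iff)
      qed
    qed
    have sub: "?f ` ?A S \<subseteq> PiE S (\<lambda>_. {..t})" by auto
    have fin: "finite (PiE S (\<lambda>_. {..t}))" by (rule finite_PiE) auto
    have "finite (?A S)" using finite_subset[OF sub fin] inj by (rule finite_imageD)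
    moreover have "card (?A S) \<le> card (PiE S (\<lambda>_. {..t}))"
      using inj sub fin by (rule card_inj_on_le)
    ultimately show ?thesis by (simp add: card_PiE)
  qed
  have B: "?B = (\<Union>S\<in>\<Delta>. ?A S)" by auto
  show "finite ?B" unfolding B using A by (intro finite_UN_I) auto
  have "card ?B \<le> (\<Sum>S\<in>\<Delta>. card (?A S))" unfolding B by (rule card_UN_le) simp
  also have "\<dots> \<le> (\<Sum>S\<in>\<Delta>. (t + 1) ^ D)"
  proof (rule sum_mono)
    fix S assume "S \<in> \<Delta>"
    then have "(t + 1) ^ card S \<le> (t + 1) ^ D" by (intro power_increasing assms) auto
    then show "card (?A S) \<le> (t + 1) ^ D" using A[of S] by linarith
  qed
  finally show "card ?B \<le> card \<Delta> * (t + 1) ^ D" by simp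
qed

lemma lookup_const_mult:
  "Poly_Mapping.lookup (const c * p) m = c * Poly_Mapping.lookup p m"
proof -
  have "const c * p = (\<Sum>n\<in>Poly_Mapping.keys p. Poly_Mapping.single n (c * Poly_Mapping.lookup p n))"
    by (subst (1) poly_mapping_sum_single[symmetric])
      (simp add: sum_distrib_left const_def mult_single)
  then show ?thesis
    by (auto simp: lookup_sum lookup_single when_def in_keys_iff sum.If_cases)
qed

text \<open>
  More than \<open>D\<close> elements are algebraically dependent modulo the ideal: there are
  \<open>(s + 1) ^ n\<close> products of them with exponents at most \<open>s\<close>, but modulo the ideal these
  live in a space whose dimension is at most a constant times \<open>(s + 1) ^ D\<close>.
\<close>
lemma algebraic_relation_exists:
  fixes \<Delta> :: "'v::finite set set" and y :: "nat \<Rightarrow> ('v, 'k::field) mpoly"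
  assumes D: "\<And>S. S \<in> \<Delta> \<Longrightarrow> card S \<le> D" and n: "D < n"
  shows "\<exists>A c. finite A \<and> A \<noteq> {} \<and> (\<forall>a\<in>A. length a = n \<and> c a \<noteq> 0)
    \<and> (\<Sum>a\<in>A. const (c a) * (\<Prod>i<n. y i ^ (a ! i))) \<in> stanley_reisner_ideal \<Delta>"
proof -
  obtain d where d: "\<And>i. i < n \<Longrightarrow> exponents_le d (y i)" using exponents_le_exists[of n y] by blast
  \<comment> \<open>\<open>s\<close> is just large enough for \<open>card \<Delta> * (C * (s + 1)) ^ D < (s + 1) ^ Suc D\<close>\<close>
  define C where "C = n * d + 1"
  define s where "s = card \<Delta> * C ^ D"
  define t where "t = n * (s * d)"
  let ?A = "{a. set a \<subseteq> {..s} \<and> length a = n}"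
  let ?B = "{m. Poly_Mapping.keys m \<in> \<Delta> \<and> (\<forall>v. Poly_Mapping.lookup m v \<le> t)}"
  let ?y = "\<lambda>a. \<Prod>i<n. y i ^ (a ! i)"
  have "t + 1 \<le> C * (s + 1)" by (simp add: t_def C_def algebra_simps)
  then have "(t + 1) ^ D \<le> (C * (s + 1)) ^ D" by (intro power_mono) auto
  then have "card \<Delta> * (t + 1) ^ D \<le> card \<Delta> * (C * (s + 1)) ^ D" by (rule mult_le_mono2)
  also have "\<dots> = s * (s + 1) ^ D" by (simp only: power_mult_distrib s_def mult.assoc)
  also have "\<dots> < (s + 1) ^ Suc D" by simp
  also have "\<dots> \<le> (s + 1) ^ n" using n by (intro power_increasing) auto
  also have "\<dots> = card ?A" by (simp add: card_lists_length_eq)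
  finally have "card \<Delta> * (t + 1) ^ D < card ?A" .
  moreover have "card ?B \<le> card \<Delta> * (t + 1) ^ D"
    by (rule card_bounded_face_monomials(2)) (rule D)
  ultimately have "card ?B < card ?A" by linarith
  moreover have "finite ?A" by (rule finite_lists_length_eq) simp
  moreover have "finite ?B" by (rule card_bounded_face_monomials(1)[of \<Delta> D t]) (rule D)
  ultimately obtain c where c: "\<exists>a\<in>?A. c a \<noteq> 0"
    "\<forall>m\<in>?B. (\<Sum>a\<in>?A. c a * Poly_Mapping.lookup (?y a) m) = 0"
    using linear_dependence[of ?B ?A "\<lambda>a m. Poly_Mapping.lookup (?y a) m"] by blast
  define A where "A = {a \<in> ?A. c a \<noteq> 0}"
  have "finite A" unfolding A_def using \<open>finite ?A\<close> by (rule finite_subset[rotated]) blast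
  have ex: "exponents_le t (?y a)" if "a \<in> A" for a
    unfolding t_def
  proof (rule exponents_le_prod)
    fix i assume i: "i < n"
    have "length a = n" "set a \<subseteq> {..s}" using that by (auto simp: A_def)
    then have "a ! i \<le> s" using i nth_mem[of i a] by (metis atMost_iff subset_iff)
    then show "exponents_le (s * d) (y i ^ (a ! i))"
      using exponents_le_mono[OF exponents_le_power[OF d[OF i]]] by simp
  qed
  have "(\<Sum>a\<in>A. const (c a) * ?y a) \<in> stanley_reisner_ideal \<Delta>"
    unfolding stanley_reisner_ideal_def
  proof (intro CollectI ballI notI)
    fix m assume m: "m \<in> Poly_Mapping.keys (\<Sum>a\<in>A. const (c a) * ?y a)" "Poly_Mapping.keys m \<in> \<Delta>"
    have look: "Poly_Mapping.lookup (\<Sum>a\<in>A. const (c a) * ?y a) m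
      = (\<Sum>a\<in>A. c a * Poly_Mapping.lookup (?y a) m)"
      by (simp add: lookup_sum lookup_const_mult)
    with m(1) have ne: "(\<Sum>a\<in>A. c a * Poly_Mapping.lookup (?y a) m) \<noteq> 0" by (simp add: in_keys_iff)
    then obtain a where a: "a \<in> A" "c a * Poly_Mapping.lookup (?y a) m \<noteq> 0"
      by (rule sum.not_neutral_contains_not_neutral)
    then have "m \<in> Poly_Mapping.keys (?y a)" by (simp add: in_keys_iff)
    then have "m \<in> ?B" using ex[OF a(1)] m(2) by (simp add: exponents_le_def)
    moreover have "(\<Sum>a\<in>A. c a * Poly_Mapping.lookup (?y a) m) = (\<Sum>a\<in>?A. c a * Poly_Mapping.lookup (?y a) m)"
      using \<open>finite ?A\<close> by (intro sum.mono_neutral_left) (auto simp: A_def)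
    ultimately show False using ne c(2) by auto
  qed
  moreover have "A \<noteq> {}" using c(1) by (auto simp: A_def)
  ultimately show ?thesis using \<open>finite A\<close> by (intro exI[of _ A] exI[of _ c]) (auto simp: A_def)
qed
text \<open>
  Pulled back to the polynomial ring, the first prime of the chain contains the Stanley-Reisner
  ideal and hence every relation modulo that ideal; elements separating more than \<open>D\<close> steps
  of the chain would satisfy such a relation.
\<close>
lemma prime_chain_length_le:
  fixes \<Delta> :: "'v::finite set set"
  assumes \<Delta>: "simplicial_complex \<Delta>" and D: "\<And>S. S \<in> \<Delta> \<Longrightarrow> card S \<le> D"
  defines "A \<equiv> (mpoly_ring :: ('v, 'k::field) mpoly ring) Quot (stanley_reisner_ideal \<Delta>)"
  assumes P: "\<And>i. i \<le> n \<Longrightarrow> primeideal (P i) A" and strict: "\<And>i. i < n \<Longrightarrow> P i \<subset> P (Suc i)"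
  shows "n \<le> D"
proof (rule ccontr)
  assume "\<not> n \<le> D"
  then have n: "D < n" by simp
  define I where "I = (stanley_reisner_ideal \<Delta> :: ('v, 'k) mpoly set)"
  let ?R = "mpoly_ring :: ('v, 'k) mpoly ring"
  have I: "ideal I ?R" unfolding I_def using \<Delta> by (rule ideal_stanley_reisner)
  note Q = quot_type_algebra[OF I]
  define V where "V i = {p. I +>\<^bsub>?R\<^esub> p \<in> P i}" for i
  have prime: "primeideal (V i) ?R" if "i \<le> n" for i
    unfolding V_def using primeideal_quot_vimage[OF I] P[OF that] by (simp add: A_def I_def)
  have "\<exists>y. y \<in> V (Suc i) - V i" if i: "i < n" for i
  proof -
    obtain x where x: "x \<in> P (Suc i)" "x \<notin> P i" using strict[OF i] by blast
    have "ideal (P (Suc i)) (?R Quot I)"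
      using P[of "Suc i"] i by (simp add: A_def I_def primeideal.axioms(1))
    then have "x \<in> carrier (?R Quot I)"
      using x(1) additive_subgroup.a_subset[OF ideal.axioms(1)] by blast
    then show ?thesis using x unfolding Q(1) V_def by blast
  qed
  then obtain y where y: "\<And>i. i < n \<Longrightarrow> y i \<in> V (Suc i) - V i" by metis
  obtain B c where B: "finite B" "B \<noteq> {}" "\<And>a. a \<in> B \<Longrightarrow> length a = n" "\<And>a. a \<in> B \<Longrightarrow> c a \<noteq> 0"
    and rel: "(\<Sum>a\<in>B. const (c a) * (\<Prod>i<n. y i ^ (a ! i))) \<in> I"
    using algebraic_relation_exists[OF D n, of \<Delta> y] unfolding I_def by blast
  have "I \<subseteq> V 0"
  proof
    fix p assume "p \<in> I"
    then have "I +>\<^bsub>?R\<^esub> p = I +>\<^bsub>?R\<^esub> 0" by (simp add: Q(6))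
    moreover have "ideal (P 0) (?R Quot I)" using P[of 0] by (simp add: A_def I_def primeideal.axioms(1))
    then have "\<zero>\<^bsub>?R Quot I\<^esub> \<in> P 0" using additive_subgroup.zero_closed ideal.axioms(1) by blast
    ultimately show "p \<in> V 0" by (simp add: V_def Q(4))
  qed
  moreover have "(\<Sum>a\<in>B. const (c a) * (\<Prod>i<n. y i ^ (a ! i))) \<notin> V 0"
  proof (rule prime_chain_no_relation)
    show "V i \<subseteq> V (Suc i)" if "i < n" for i using strict[OF that] by (auto simp: V_def)
    show "const (c a) dvd (1 :: ('v, 'k) mpoly)" if "a \<in> B" for a
    proof
      show "1 = const (c a) * const (inverse (c a))"
        using B(4)[OF that] by (simp add: const_def mult_single)
    qed
  qed (use B prime y in auto)
  ultimately show False using rel by blast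
qed

section \<open>Lower bound for the Krull dimension\<close>

text \<open>
  The vertex type carries no order. An additive embedding into exponent vectors over the
  naturals, which are linearly ordered compatibly with addition, supplies a monomial order.
\<close>
lemma monomial_order_exists:
  "\<exists>\<phi> :: ('v::finite \<Rightarrow>\<^sub>0 nat) \<Rightarrow> (nat \<Rightarrow>\<^sub>0 nat). inj \<phi> \<and> (\<forall>a b. \<phi> (a + b) = \<phi> a + \<phi> b)"
proof -
  obtain idx :: "'v \<Rightarrow> nat" where idx: "inj idx"
    using finite_imp_inj_to_nat_seg[OF finite_class.finite_UNIV] by blast
  define \<phi> where "\<phi> m = (\<Sum>v\<in>UNIV. Poly_Mapping.single (idx v) (Poly_Mapping.lookup m v))"
    for m :: "'v \<Rightarrow>\<^sub>0 nat"
  have "\<phi> (a + b) = \<phi> a + \<phi> b" for a b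
    by (simp add: \<phi>_def lookup_add single_add sum.distrib)
  moreover have "Poly_Mapping.lookup (\<phi> m) (idx v) = Poly_Mapping.lookup m v" for m v
    using idx by (simp add: \<phi>_def lookup_sum lookup_single when_def inj_eq)
  then have "inj \<phi>" by (intro injI poly_mapping_eqI) metis
  ultimately show ?thesis by blast
qed

lemma mult_eq_sum_single:
  "p * q = (\<Sum>m\<in>Poly_Mapping.keys p. \<Sum>n\<in>Poly_Mapping.keys q.
     Poly_Mapping.single (m + n) (Poly_Mapping.lookup p m * Poly_Mapping.lookup q n))"
proof -
  have "p * q = (\<Sum>m\<in>Poly_Mapping.keys p. Poly_Mapping.single m (Poly_Mapping.lookup p m))
     * (\<Sum>n\<in>Poly_Mapping.keys q. Poly_Mapping.single n (Poly_Mapping.lookup q n))"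
    by (simp only: poly_mapping_sum_single)
  then show ?thesis by (simp add: sum_product mult_single)
qed

text \<open>
  This is the ideal generated by the variables outside \<open>F\<close>. If neither factor lies in it, the
  product of their leading monomials among those supported on \<open>F\<close> occurs in the product, and
  it is again supported on \<open>F\<close>.
\<close>
lemma primeideal_stanley_reisner_simplex:
  "primeideal (stanley_reisner_ideal (Pow F) :: ('v::finite, 'k::field) mpoly set) mpoly_ring"
proof (rule primeidealI)
  let ?R = "mpoly_ring :: ('v, 'k) mpoly ring"
  let ?V = "stanley_reisner_ideal (Pow F) :: ('v, 'k) mpoly set"
  have cx: "simplicial_complex (Pow F)" by (auto simp: simplicial_complex_def)
  show "ideal ?V ?R" using cx by (rule ideal_stanley_reisner)
  show "cring ?R" by (rule cring_from_type_algebra)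
  show "carrier ?R \<noteq> ?V" using one_notin_stanley_reisner[OF cx, where 'k = 'k] by auto
  obtain \<phi> :: "('v \<Rightarrow>\<^sub>0 nat) \<Rightarrow> (nat \<Rightarrow>\<^sub>0 nat)"
    where \<phi>: "inj \<phi>" "\<And>a b. \<phi> (a + b) = \<phi> a + \<phi> b" using monomial_order_exists by blast
  have leading: "\<exists>a\<in>Poly_Mapping.keys p. Poly_Mapping.keys a \<subseteq> F \<and>
      (\<forall>m\<in>Poly_Mapping.keys p. Poly_Mapping.keys m \<subseteq> F \<longrightarrow> \<phi> m \<le> \<phi> a)"
    if "p \<notin> ?V" for p
  proof -
    let ?K = "{m \<in> Poly_Mapping.keys p. Poly_Mapping.keys m \<subseteq> F}"
    have "?K \<noteq> {}" using that by (auto simp: stanley_reisner_ideal_def)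
    then have "Max (\<phi> ` ?K) \<in> \<phi> ` ?K" by (intro Max_in) auto
    then obtain a where a: "a \<in> ?K" "\<phi> a = Max (\<phi> ` ?K)" by auto
    have "\<phi> m \<le> \<phi> a" if "m \<in> ?K" for m unfolding a(2) using that by (intro Max_ge) auto
    then show ?thesis using a(1) by blast
  qed
  fix p q assume pq: "p \<otimes>\<^bsub>?R\<^esub> q \<in> ?V"
  show "p \<in> ?V \<or> q \<in> ?V"
  proof (rule ccontr)
    assume "\<not> (p \<in> ?V \<or> q \<in> ?V)"
    then have pV: "p \<notin> ?V" and qV: "q \<notin> ?V" by auto
    obtain a where a: "a \<in> Poly_Mapping.keys p" "Poly_Mapping.keys a \<subseteq> F"
        "\<And>m. m \<in> Poly_Mapping.keys p \<Longrightarrow> Poly_Mapping.keys m \<subseteq> F \<Longrightarrow> \<phi> m \<le> \<phi> a"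
      using leading[OF pV] by blast
    obtain b where b: "b \<in> Poly_Mapping.keys q" "Poly_Mapping.keys b \<subseteq> F"
        "\<And>m. m \<in> Poly_Mapping.keys q \<Longrightarrow> Poly_Mapping.keys m \<subseteq> F \<Longrightarrow> \<phi> m \<le> \<phi> b"
      using leading[OF qV] by blast
    have uniq: "m = a \<and> n = b"
      if mn: "m \<in> Poly_Mapping.keys p" "n \<in> Poly_Mapping.keys q" "m + n = a + b" for m n
    proof -
      have "Poly_Mapping.keys m \<union> Poly_Mapping.keys n \<subseteq> F"
        using a(2) b(2) by (metis keys_add_nat mn(3) Un_least)
      then have le: "\<phi> m \<le> \<phi> a" "\<phi> n \<le> \<phi> b" using a(3) b(3) mn(1,2) by auto
      have eq: "\<phi> m + \<phi> n = \<phi> a + \<phi> b" using mn(3) by (simp flip: \<phi>(2))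
      have "\<not> \<phi> m < \<phi> a" using add_less_le_mono[of "\<phi> m" "\<phi> a" "\<phi> n" "\<phi> b"] le(2) eq by auto
      then have "\<phi> m = \<phi> a" using le(1) by simp
      with eq have "\<phi> n = \<phi> b" by simp
      with \<open>\<phi> m = \<phi> a\<close> show ?thesis using \<phi>(1) by (simp add: inj_eq)
    qed
    have "Poly_Mapping.lookup (p * q) (a + b)
      = (\<Sum>m\<in>Poly_Mapping.keys p. \<Sum>n\<in>Poly_Mapping.keys q.
          if m + n = a + b then Poly_Mapping.lookup p m * Poly_Mapping.lookup q n else 0)"
      by (simp add: mult_eq_sum_single[of p q] lookup_sum lookup_single when_def)
    also have "\<dots> = (\<Sum>m\<in>Poly_Mapping.keys p. \<Sum>n\<in>Poly_Mapping.keys q.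
          if m = a then if n = b then Poly_Mapping.lookup p a * Poly_Mapping.lookup q b else 0 else 0)"
      by (intro sum.cong refl) (auto dest: uniq)
    also have "\<dots> = (\<Sum>m\<in>Poly_Mapping.keys p.
        if m = a then Poly_Mapping.lookup p a * Poly_Mapping.lookup q b else 0)"
      using b(1) by (intro sum.cong refl) auto
    also have "\<dots> = Poly_Mapping.lookup p a * Poly_Mapping.lookup q b"
      using a(1) by simp
    also have "\<dots> \<noteq> 0" using a(1) b(1) by (simp add: in_keys_iff)
    finally have "a + b \<in> Poly_Mapping.keys (p * q)" by (simp add: in_keys_iff)
    moreover have "Poly_Mapping.keys (a + b) \<in> Pow F" using a(2) b(2) by (simp add: keys_add_nat)
    ultimately show False using pq by (auto simp: stanley_reisner_ideal_def)
  qed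
qed

text \<open>
  Removing the vertices of the face one by one gives a chain of ideals generated by variables.
\<close>
lemma prime_chain_exists:
  fixes \<Delta> :: "'v::finite set set"
  assumes \<Delta>: "simplicial_complex \<Delta>" and S: "S \<in> \<Delta>"
  defines "A \<equiv> (mpoly_ring :: ('v, 'k::field) mpoly ring) Quot (stanley_reisner_ideal \<Delta>)"
  shows "\<exists>P. (\<forall>i\<le>card S. primeideal (P i) A) \<and> (\<forall>i<card S. P i \<subset> P (Suc i))"
proof -
  define I where "I = (stanley_reisner_ideal \<Delta> :: ('v, 'k) mpoly set)"
  let ?R = "mpoly_ring :: ('v, 'k) mpoly ring"
  have I: "ideal I ?R" unfolding I_def using \<Delta> by (rule ideal_stanley_reisner)
  obtain vs where vs: "set vs = S" "distinct vs" using finite_distinct_list[OF finite] by blast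
  define F where "F i = set (drop i vs)" for i
  define V where "V i = (stanley_reisner_ideal (Pow (F i)) :: ('v, 'k) mpoly set)" for i
  have "Pow (F i) \<subseteq> \<Delta>" for i
    using \<Delta> S vs(1) set_drop_subset[of i vs] unfolding F_def simplicial_complex_def by blast
  then have sub: "I \<subseteq> V i" for i by (auto simp: I_def V_def stanley_reisner_ideal_def)
  note img = primeideal_quot_image[OF I primeideal_stanley_reisner_simplex sub[unfolded V_def], folded V_def]
  have V_strict: "V i \<subset> V (Suc i)" if i: "i < card S" for i
  proof
    have len: "i < length vs" using i distinct_card[OF vs(2)] vs(1) by simp
    then have drop: "drop i vs = vs ! i # drop (Suc i) vs" by (simp add: Cons_nth_drop_Suc)
    then have "F (Suc i) \<subseteq> F i" by (auto simp: F_def)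
    then show "V i \<subseteq> V (Suc i)" by (auto simp: V_def stanley_reisner_ideal_def)
    have "distinct (drop i vs)" using vs(2) by simp
    then have "vs ! i \<in> F i" "vs ! i \<notin> F (Suc i)" unfolding F_def drop by auto
    then have "var (vs ! i) \<in> V (Suc i)" "var (vs ! i) \<notin> V i"
      by (auto simp: V_def stanley_reisner_ideal_def var_def)
    then show "V i \<noteq> V (Suc i)" by blast
  qed
  have strict: "(\<lambda>p. I +>\<^bsub>?R\<^esub> p) ` V i \<subset> (\<lambda>p. I +>\<^bsub>?R\<^esub> p) ` V (Suc i)" if i: "i < card S" for i
  proof
    show "(\<lambda>p. I +>\<^bsub>?R\<^esub> p) ` V i \<subseteq> (\<lambda>p. I +>\<^bsub>?R\<^esub> p) ` V (Suc i)"
      using V_strict[OF i] by (intro image_mono) blast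
    obtain p where "p \<in> V (Suc i)" "p \<notin> V i" using V_strict[OF i] by blast
    then have "I +>\<^bsub>?R\<^esub> p \<in> (\<lambda>p. I +>\<^bsub>?R\<^esub> p) ` V (Suc i)"
      "I +>\<^bsub>?R\<^esub> p \<notin> (\<lambda>p. I +>\<^bsub>?R\<^esub> p) ` V i" by (simp_all only: img(2) not_False_eq_True)
    then show "(\<lambda>p. I +>\<^bsub>?R\<^esub> p) ` V i \<noteq> (\<lambda>p. I +>\<^bsub>?R\<^esub> p) ` V (Suc i)" by metis
  qed
  show ?thesis
    unfolding A_def I_def[symmetric] using img(1) strict
    by (intro exI[of _ "\<lambda>i. (\<lambda>p. I +>\<^bsub>?R\<^esub> p) ` V i"]) blast
qed

lemma quot_dim_stanley_reisner:
  fixes \<Delta> :: "'v::finite set set"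
  assumes \<Delta>: "simplicial_complex \<Delta>"
  shows "quot_dim (stanley_reisner_ideal \<Delta> :: ('v, 'k::field) mpoly set) = Max (card ` \<Delta>)"
proof -
  let ?A = "(mpoly_ring :: ('v, 'k) mpoly ring) Quot (stanley_reisner_ideal \<Delta>)"
  let ?D = "Max (card ` \<Delta>)"
  have D: "card S \<le> ?D" if "S \<in> \<Delta>" for S using that by (intro Max_ge) auto
  have "?D \<in> card ` \<Delta>" using \<Delta> by (intro Max_in) (auto simp: simplicial_complex_def)
  then obtain S where S: "S \<in> \<Delta>" "card S = ?D" by auto
  have "krull_dim ?A = enat ?D"
    unfolding krull_dim_def
  proof (rule Sup_eqI)
    fix x assume "x \<in> {enat m | m. \<exists>P. (\<forall>i\<le>m. primeideal (P i) ?A) \<and> (\<forall>i<m. P i \<subset> P (Suc i))}"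
    then obtain m P where "x = enat m" "\<forall>i\<le>m. primeideal (P i) ?A" "\<forall>i<m. P i \<subset> P (Suc i)" by blast
    then show "x \<le> enat ?D" using prime_chain_length_le[OF \<Delta> D, of m P] by auto
  next
    fix x assume ub: "\<And>y. y \<in> {enat m | m. \<exists>P. (\<forall>i\<le>m. primeideal (P i) ?A) \<and> (\<forall>i<m. P i \<subset> P (Suc i))} \<Longrightarrow> y \<le> x"
    show "enat ?D \<le> x"
      by (rule ub) (use prime_chain_exists[OF \<Delta> S(1), where 'k = 'k] in \<open>auto simp: S(2)\<close>)
  qed
  then show ?thesis by (simp add: quot_dim_def)
qed

section \<open>Homogenisation and the order at -1\<close>

text \<open>
  The homogenisation of \<open>p\<close> in degree \<open>n\<close>, evaluated at \<open>(a, b)\<close>. With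
  \<open>(t, 1 - t)\<close> it gives the h-polynomial, with \<open>(1, x)\<close> the reversed polynomial
  \<open>x ^ n * p(1 / x)\<close>.
\<close>
definition homogenize :: "nat \<Rightarrow> 'a::idom poly \<Rightarrow> 'a poly \<Rightarrow> 'a poly \<Rightarrow> 'a poly" where
  "homogenize n a b p = (\<Sum>i\<le>n. Polynomial.smult (Polynomial.coeff p i) (a ^ i * b ^ (n - i)))"

lemma homogenize_sum: "homogenize n a b (\<Sum>x\<in>A. f x) = (\<Sum>x\<in>A. homogenize n a b (f x))"
  unfolding homogenize_def by (subst sum.swap) (simp add: Polynomial.coeff_sum smult_sum)

lemma homogenize_monom:
  "k \<le> n \<Longrightarrow> homogenize n a b (Polynomial.monom 1 k) = a ^ k * b ^ (n - k)"
proof -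
  assume "k \<le> n"
  have "homogenize n a b (Polynomial.monom 1 k) = (\<Sum>i\<le>n. if i = k then a ^ k * b ^ (n - k) else 0)"
    unfolding homogenize_def by (rule sum.cong) auto
  with \<open>k \<le> n\<close> show ?thesis by simp
qed

lemma homogenize_times_linear:
  assumes "Polynomial.degree p \<le> n"
  shows "homogenize (Suc n) a b ([:1, 1:] * p) = (a + b) * homogenize n a b p"
proof -
  have "homogenize (Suc n) a b ([:1, 1:] * p)
    = homogenize (Suc n) a b p + homogenize (Suc n) a b (pCons 0 p)"
    by (simp add: homogenize_def smult_add_left sum.distrib del: sum.atMost_Suc)
  also have "homogenize (Suc n) a b p = b * homogenize n a b p"
    using assms by (simp add: homogenize_def Polynomial.coeff_eq_0 sum_distrib_left Suc_diff_le mult_ac)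
  also have "homogenize (Suc n) a b (pCons 0 p) = a * homogenize n a b p"
    by (simp add: homogenize_def sum.atMost_Suc_shift sum_distrib_left mult_ac del: sum.atMost_Suc)
  finally show ?thesis by (simp add: algebra_simps)
qed

lemma homogenize_times_linear_power:
  assumes "Polynomial.degree p \<le> n"
  shows "homogenize (M + n) a b ([:1, 1:] ^ M * p) = (a + b) ^ M * homogenize n a b p"
proof (induction M)
  case (Suc M)
  have "Polynomial.degree ([:1, 1:] ^ M * p) \<le> M + n"
    using degree_mult_le[of "[:1, 1:] ^ M" p] degree_power_le[of "[:1, 1:] :: 'a poly" M] assms
    by simp
  from homogenize_times_linear[OF this, of a b] Suc show ?case
    unfolding power_Suc mult.assoc add_Suc by (simp only:)
qed simp

lemma poly_homogenize:
  "poly (homogenize n a b p) x = (\<Sum>i\<le>n. Polynomial.coeff p i * (poly a x ^ i * poly b x ^ (n - i)))"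
  by (simp add: homogenize_def poly_sum)

lemma alternating_sum_eq_poly:
  fixes p :: "'a::idom poly"
  assumes "Polynomial.degree p \<le> n"
  shows "(\<Sum>i\<le>n. Polynomial.coeff p i * (- 1) ^ (n - i)) = (- 1) ^ n * poly p (- 1)"
proof -
  have "(- 1 :: 'a) ^ (n - i) = (- 1) ^ n * (- 1) ^ i" if "i \<le> n" for i
    using that by (auto simp: minus_one_power_iff)
  then have "(\<Sum>i\<le>n. Polynomial.coeff p i * (- 1) ^ (n - i))
     = (- 1) ^ n * (\<Sum>i\<le>n. Polynomial.coeff p i * (- 1) ^ i)"
    unfolding sum_distrib_left by (intro sum.cong) (auto simp: mult_ac)
  also have "(\<Sum>i\<le>n. Polynomial.coeff p i * (- 1) ^ i) = poly p (- 1)"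
    unfolding poly_altdef
    by (rule sum.mono_neutral_right) (use assms in \<open>auto simp: Polynomial.coeff_eq_0\<close>)
  finally show ?thesis .
qed

lemma order_minus_one_decomp:
  fixes p :: "'a::idom poly"
  assumes "p \<noteq> 0"
  obtains q where "p = [:1, 1:] ^ Polynomial.order (- 1) p * q" "poly q (- 1) \<noteq> 0"
    "Polynomial.degree p = Polynomial.order (- 1) p + Polynomial.degree q"
proof -
  obtain q where q: "p = [:1, 1:] ^ Polynomial.order (- 1) p * q" "\<not> [:1, 1:] dvd q"
    using order_decomp[OF assms, of "- 1"] by auto
  then have "q \<noteq> 0" by auto
  then have "Polynomial.degree p = Polynomial.order (- 1) p + Polynomial.degree q"
    by (subst q(1)) (simp add: degree_mult_eq degree_power_eq)
  moreover have "poly q (- 1) \<noteq> 0" using q(2) by (simp add: poly_eq_0_iff_dvd)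
  ultimately show ?thesis using q(1) that by blast
qed

lemma order_minus_one_eqI:
  fixes q :: "'a::idom poly"
  assumes "p = [:1, 1:] ^ M * q" "poly q (- 1) \<noteq> 0"
  shows "Polynomial.order (- 1) p = M"
proof -
  have "\<not> [:1, 1:] dvd q" using assms(2) poly_eq_0_iff_dvd[of q "- 1"] by simp
  then have "\<not> [:1, 1:] ^ Suc M dvd p"
    by (simp only: assms(1) power_Suc2 dvd_mult_cancel_left) auto
  then show ?thesis using assms(1) by (intro order_unique_lemma) auto
qed

text \<open>
  The factors \<open>1 + x\<close> of \<open>p\<close> become \<open>t + (1 - t) = 1\<close>, and the coefficient of
  \<open>t ^ k\<close> in the homogenisation of the cofactor \<open>q\<close> in degree \<open>k = n - M\<close> is
  \<open>q(-1)\<close> up to sign, where \<open>M\<close> is the order.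
\<close>
lemma degree_homogenize:
  fixes p :: "'a::idom poly"
  assumes "p \<noteq> 0" "Polynomial.degree p \<le> n"
  shows "Polynomial.degree (homogenize n [:0, 1:] [:1, -1:] p) = n - Polynomial.order (- 1) p"
proof -
  obtain q where q: "p = [:1, 1:] ^ Polynomial.order (- 1) p * q" "poly q (- 1) \<noteq> 0"
    "Polynomial.degree p = Polynomial.order (- 1) p + Polynomial.degree q"
    using order_minus_one_decomp[OF assms(1)] by metis
  define M k where "M = Polynomial.order (- 1) p" and "k = n - M"
  have k: "n = M + k" "Polynomial.degree q \<le> k" using q(3) assms(2) by (auto simp: M_def k_def)
  let ?h = "homogenize k [:0, 1:] [:1, -1:] q"
  have "[:0, 1:] + [:1, -1:] = (1 :: 'a poly)" by (simp add: one_pCons)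
  then have "homogenize n [:0, 1:] [:1, -1:] p = ?h"
    using homogenize_times_linear_power[OF k(2), of M "[:0, 1:]" "[:1, -1:]"] q(1)
    by (simp only: k(1) M_def power_one mult_1_left)
  moreover have "Polynomial.degree ?h = k"
  proof (rule antisym)
    have deg: "Polynomial.degree ([:0, 1:] ^ i * [:1, -1:] ^ (k - i) :: 'a poly) = k" if "i \<le> k" for i
      using that by (simp add: degree_mult_eq degree_power_eq)
    show "Polynomial.degree ?h \<le> k"
      unfolding homogenize_def
      by (intro degree_sum_le) (auto intro!: order.trans[OF degree_smult_le] simp: deg)
    have "Polynomial.coeff ([:0, 1:] ^ i * [:1, -1:] ^ (k - i) :: 'a poly) k = (- 1) ^ (k - i)"
      if "i \<le> k" for i
    proof -
      have "Polynomial.coeff ([:0, 1:] ^ i * [:1, -1:] ^ (k - i) :: 'a poly) k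
        = lead_coeff ([:0, 1:] ^ i * [:1, -1:] ^ (k - i) :: 'a poly)"
        using deg[OF that] by simp
      then show ?thesis by (simp add: lead_coeff_mult lead_coeff_power)
    qed
    then have "Polynomial.coeff ?h k = (\<Sum>i\<le>k. Polynomial.coeff q i * (- 1) ^ (k - i))"
      by (simp add: homogenize_def Polynomial.coeff_sum)
    also have "\<dots> \<noteq> 0" using q(2) by (simp add: alternating_sum_eq_poly[OF k(2)])
    finally show "k \<le> Polynomial.degree ?h" by (rule le_degree)
  qed
  ultimately show ?thesis by (simp add: k_def M_def)
qed

section \<open>The a-invariant of a Stanley-Reisner ring\<close>

definition face_poly :: "'v set set \<Rightarrow> int poly" where
  "face_poly \<Delta> = (\<Sum>S\<in>\<Delta>. Polynomial.monom 1 (card S))"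

lemma degree_face_poly_le:
  fixes \<Delta> :: "'v::finite set set"
  shows "(\<And>S. S \<in> \<Delta> \<Longrightarrow> card S \<le> D) \<Longrightarrow> Polynomial.degree (face_poly \<Delta>) \<le> D"
  unfolding face_poly_def
  by (rule degree_sum_le) (auto intro: order.trans[OF degree_monom_le])

lemma face_poly_nonzero:
  fixes \<Delta> :: "'v::finite set set"
  assumes "\<Delta> \<noteq> {}"
  shows "face_poly \<Delta> \<noteq> 0"
proof
  assume "face_poly \<Delta> = 0"
  moreover have "poly (face_poly \<Delta>) 1 = int (card \<Delta>)"
    by (simp add: face_poly_def poly_sum poly_monom)
  ultimately show False using assms by simp
qed

lemma homogenize_face_poly:
  assumes "\<And>S. S \<in> \<Delta> \<Longrightarrow> card S \<le> n"
  shows "homogenize n a b (face_poly \<Delta>) = (\<Sum>S\<in>\<Delta>. a ^ card S * b ^ (n - card S))"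
  unfolding face_poly_def homogenize_sum
  by (intro sum.cong refl homogenize_monom assms)

lemma a_invariant_stanley_reisner:
  fixes \<Delta> :: "'v::finite set set"
  assumes \<Delta>: "simplicial_complex \<Delta>"
  shows "a_invariant (stanley_reisner_ideal \<Delta> :: ('v, 'k::field) mpoly set)
    = - int (Polynomial.order (- 1) (face_poly \<Delta>))"
proof -
  let ?I = "stanley_reisner_ideal \<Delta> :: ('v, 'k) mpoly set"
  define D where "D = Max (card ` \<Delta>)"
  have D: "card S \<le> D" if "S \<in> \<Delta>" for S
    unfolding D_def using that by (intro Max_ge) auto
  have dim: "quot_dim ?I = D" unfolding D_def using \<Delta> by (rule quot_dim_stanley_reisner)
  let ?h = "homogenize D [:0, 1:] [:1, -1:] (face_poly \<Delta>)"
  have "[:1, -1:] = (1 - [:0, 1:] :: int poly)" by (simp add: one_pCons)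
  then have X: "fps_of_poly [:0, 1 :: int:] = fps_X" "fps_of_poly [:1, -1 :: int:] = 1 - fps_X"
    by (simp_all add: fps_of_poly_diff)
  have "fps_of_poly ?h = hilbert_series ?I * (1 - fps_X) ^ quot_dim ?I"
    by (simp only: hilbert_series_stanley_reisner[OF \<Delta> D] dim homogenize_face_poly[OF D]
      fps_of_poly_sum fps_of_poly_mult fps_of_poly_power X)
  then have "h_poly ?I = ?h"
    unfolding h_poly_def by (intro the_equality) (auto simp: fps_of_poly_eq_iff)
  moreover have F: "face_poly \<Delta> \<noteq> 0"
    using \<Delta> by (intro face_poly_nonzero) (auto simp: simplicial_complex_def)
  moreover have "Polynomial.degree (face_poly \<Delta>) \<le> D" by (intro degree_face_poly_le D)
  moreover have "Polynomial.order (- 1) (face_poly \<Delta>) \<le> Polynomial.degree (face_poly \<Delta>)"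
    by (rule order_degree[OF F])
  ultimately show ?thesis by (simp add: a_invariant_def dim degree_homogenize)
qed

section \<open>The two complexes of a graph\<close>

lemma edge_ideal_stanley_reisner:
  assumes "simple_graph E"
  shows "(edge_ideal E :: ('v::finite, 'k::field) mpoly set)
    = stanley_reisner_ideal {S. independent_set E S}"
proof -
  have "{var i * var j :: ('v, 'k) mpoly | i j. {i, j} \<in> E} = {\<Prod>i\<in>G. var i | G. G \<in> E}"
  proof (intro equalityI subsetI)
    fix p :: "('v, 'k) mpoly" assume "p \<in> {var i * var j | i j. {i, j} \<in> E}"
    then obtain i j where p: "p = var i * var j" "{i, j} \<in> E" by auto
    then have "i \<noteq> j" using assms by (auto simp: simple_graph_def)
    with p show "p \<in> {\<Prod>i\<in>G. var i | G. G \<in> E}"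
      by (intro CollectI exI[of _ "{i, j}"]) auto
  next
    fix p :: "('v, 'k) mpoly" assume "p \<in> {\<Prod>i\<in>G. var i | G. G \<in> E}"
    then obtain G where p: "p = (\<Prod>i\<in>G. var i)" "G \<in> E" by auto
    then obtain i j where "G = {i, j}" "i \<noteq> j"
      using assms by (auto simp: simple_graph_def card_2_iff)
    with p show "p \<in> {var i * var j | i j. {i, j} \<in> E}" by auto
  qed
  then show ?thesis
    by (auto simp: edge_ideal_def squarefree_monomial_ideal stanley_reisner_ideal_def
        independent_set_def)
qed

lemma minimal_vertex_cover_exists:
  fixes C :: "'v::finite set"
  assumes "vertex_cover E C"
  shows "\<exists>D\<subseteq>C. minimal_vertex_cover E D"
proof -
  obtain D where "D \<subseteq> C" "vertex_cover E D" "\<And>D'. D' \<subseteq> D \<Longrightarrow> vertex_cover E D' \<Longrightarrow> D' = D"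
    using finite_has_minimal2[of "{D. vertex_cover E D}" C] assms by simp blast
  then show ?thesis unfolding minimal_vertex_cover_def by blast
qed

text \<open>
  The generators of the cover ideal are the minimal vertex covers, so a monomial lies in it iff
  its support is a vertex cover.
\<close>
lemma cover_ideal_stanley_reisner:
  "(cover_ideal E :: ('v::finite, 'k::field) mpoly set)
    = stanley_reisner_ideal {S. \<not> vertex_cover E S}"
proof -
  have "(\<exists>C\<in>Collect (minimal_vertex_cover E). C \<subseteq> S) \<longleftrightarrow> vertex_cover E S" for S
  proof
    assume "\<exists>C\<in>Collect (minimal_vertex_cover E). C \<subseteq> S"
    then show "vertex_cover E S"
      unfolding minimal_vertex_cover_def vertex_cover_def by blast
  next
    assume "vertex_cover E S"
    then show "\<exists>C\<in>Collect (minimal_vertex_cover E). C \<subseteq> S"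
      using minimal_vertex_cover_exists by blast
  qed
  then show ?thesis
    using squarefree_monomial_ideal[of "Collect (minimal_vertex_cover E)", where 'k = 'k]
    by (simp add: cover_ideal_def stanley_reisner_ideal_def subset_eq)
qed
lemma independence_poly_eq_face_poly:
  "independence_poly E = face_poly {S. independent_set E S}"
proof -
  have "face_poly {S. independent_set E S}
    = (\<Sum>i\<le>card (UNIV :: 'a set). \<Sum>S | S \<in> {S. independent_set E S} \<and> card S = i. Polynomial.monom 1 (card S))"
    unfolding face_poly_def
    by (rule sum.group[symmetric]) (auto simp: card_mono)
  also have "\<dots> = independence_poly E"
    unfolding independence_poly_def
  proof (intro sum.cong refl)
    fix i
    have "(\<Sum>S | S \<in> {S. independent_set E S} \<and> card S = i. Polynomial.monom (1::int) (card S))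
      = (\<Sum>S | independent_set E S \<and> card S = i. Polynomial.monom 1 i)"
      by (intro sum.cong) auto
    also have "\<dots> = Polynomial.monom (int (card {S. independent_set E S \<and> card S = i})) i"
      by (simp add: of_nat_poly Polynomial.smult_monom)
    finally show "(\<Sum>S | S \<in> {S. independent_set E S} \<and> card S = i. Polynomial.monom (1::int) (card S))
       = Polynomial.monom (int (card {S. independent_set E S \<and> card S = i})) i" .
  qed
  finally show ?thesis by simp
qed

lemma map_poly_of_int_mult:
  "map_poly (of_int :: int \<Rightarrow> 'a::idom) (p * q) = map_poly of_int p * map_poly of_int q"
  by (intro Polynomial.poly_eqI) (simp add: coeff_map_poly Polynomial.coeff_mult)

lemma map_poly_of_int_power:
  "map_poly (of_int :: int \<Rightarrow> 'a::idom) (p ^ n) = map_poly of_int p ^ n"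
  by (induction n) (simp_all add: map_poly_of_int_mult)

lemma poly_map_poly_of_int:
  "poly (map_poly (of_int :: int \<Rightarrow> 'a::idom) p) (of_int x) = of_int (poly p x)"
  by (induction p) (simp_all add: map_poly_pCons)

text \<open>
  The factor \<open>1 + x\<close> is monic, so it can be split off over the integers, and the resulting
  factorisation persists over the rationals.
\<close>
lemma multiplicity_minus_one_eq:
  assumes "independence_poly E \<noteq> 0"
  shows "multiplicity_minus_one E = Polynomial.order (- 1) (independence_poly E)"
proof -
  let ?P = "independence_poly E"
  obtain q where q: "?P = [:1, 1:] ^ Polynomial.order (- 1) ?P * q" "poly q (- 1) \<noteq> 0"
    using order_minus_one_decomp[OF assms] by metis
  have "map_poly rat_of_int ?P
    = map_poly rat_of_int ([:1, 1:] ^ Polynomial.order (- 1) ?P * q)" using q(1) by simp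
  also have "\<dots> = [:1, 1:] ^ Polynomial.order (- 1) ?P * map_poly rat_of_int q"
    by (simp add: map_poly_of_int_mult map_poly_of_int_power map_poly_pCons)
  finally show ?thesis
    unfolding multiplicity_minus_one_def
    using q(2) poly_map_poly_of_int[of q "- 1", where 'a = rat]
    by (intro order_minus_one_eqI[of _ _ "map_poly rat_of_int q"]) auto
qed

lemma face_poly_UNIV: "face_poly (UNIV :: 'v::finite set set) = [:1, 1:] ^ card (UNIV :: 'v set)"
proof -
  have "([:1, 1:] :: int poly) = [:0, 1:] + 1" by (simp add: one_pCons)
  then have "([:1, 1:] :: int poly) ^ card (UNIV :: 'v set) = (\<Prod>v\<in>(UNIV :: 'v set). [:0, 1:] + 1)"
    by simp
  also have "\<dots> = (\<Sum>S\<in>Pow (UNIV :: 'v set). [:0, 1:] ^ card S)" by (subst prod_add) auto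
  finally show ?thesis by (simp add: face_poly_def monom_altdef)
qed

lemma vertex_cover_iff_independent: "vertex_cover E C \<longleftrightarrow> independent_set E (- C)"
  by (auto simp: vertex_cover_def independent_set_def)

lemma face_poly_vertex_covers:
  fixes E :: "'v::finite set set"
  shows "face_poly {C. vertex_cover E C}
    = homogenize (card (UNIV :: 'v set)) 1 [:0, 1:] (face_poly {S. independent_set E S})"
proof -
  have "face_poly {C. vertex_cover E C} = (\<Sum>S | independent_set E S. Polynomial.monom 1 (card (- S)))"
    unfolding face_poly_def
    by (rule sum.reindex_bij_witness[of _ uminus uminus]) (auto simp: vertex_cover_iff_independent)
  also have "\<dots> = homogenize (card (UNIV :: 'v set)) 1 [:0, 1:] (face_poly {S. independent_set E S})"
    by (subst homogenize_face_poly) (auto simp: card_mono Compl_eq_Diff_UNIV card_Diff_subset monom_altdef)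
  finally show ?thesis .
qed

text \<open>
  The face polynomial of the noncovers is \<open>(1 + x) ^ n\<close> minus the reversed independence
  polynomial. The latter has the same order \<open>M\<close> at \<open>-1\<close>, and it determines the order
  of the difference because \<open>M < n\<close>, the whole vertex set not being independent.
\<close>
lemma order_face_poly_noncovers:
  fixes E :: "'v::finite set set"
  assumes "simple_graph E" "E \<noteq> {}"
  shows "Polynomial.order (- 1) (face_poly {S. \<not> vertex_cover E S})
    = Polynomial.order (- 1) (face_poly {S. independent_set E S})"
proof -
  let ?P = "face_poly {S. independent_set E S}" and ?N = "card (UNIV :: 'v set)"
  have "{} \<in> {S. independent_set E S}"
    using assms(1) by (auto simp: independent_set_def simple_graph_def)
  then have P: "?P \<noteq> 0" by (intro face_poly_nonzero) auto
  have "card S \<le> ?N - 1" if "independent_set E S" for S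
  proof -
    have "S \<noteq> UNIV" using that assms(2) by (auto simp: independent_set_def)
    then have "card S < ?N" by (intro psubset_card_mono) auto
    then show ?thesis by simp
  qed
  then have "Polynomial.degree ?P \<le> ?N - 1" by (intro degree_face_poly_le) auto
  moreover have "?N > 0" by (simp add: card_gt_0_iff)
  ultimately have degP: "Polynomial.degree ?P < ?N" by linarith
  define M where "M = Polynomial.order (- 1) ?P"
  obtain q where q: "?P = [:1, 1:] ^ M * q" "poly q (- 1) \<noteq> 0"
    "Polynomial.degree ?P = M + Polynomial.degree q"
    using order_minus_one_decomp[OF P] unfolding M_def by metis
  define k where "k = ?N - M"
  have k: "?N = M + k" "k > 0" "Polynomial.degree q \<le> k" using degP q(3) by (auto simp: k_def)
  let ?r = "[:1, 1:] ^ k - homogenize k 1 [:0, 1:] q"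
  have "{S. \<not> vertex_cover E S} = UNIV - {C. vertex_cover E C}" by auto
  then have "face_poly {S. \<not> vertex_cover E S} = face_poly (UNIV :: 'v set set) - face_poly {C. vertex_cover E C}"
    unfolding face_poly_def by (simp only: sum_diff[OF finite subset_UNIV])
  also have "face_poly (UNIV :: 'v set set) = [:1, 1:] ^ M * [:1, 1:] ^ k"
    by (simp only: face_poly_UNIV k(1) power_add)
  also have "face_poly {C. vertex_cover E C} = homogenize (M + k) 1 [:0, 1:] ([:1, 1:] ^ M * q)"
    by (simp only: face_poly_vertex_covers k(1) flip: q(1))
  also have "\<dots> = (1 + [:0, 1:]) ^ M * homogenize k 1 [:0, 1:] q"
    by (rule homogenize_times_linear_power[OF k(3)])
  also have "1 + [:0, 1:] = ([:1, 1:] :: int poly)" by (simp add: one_pCons)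
  finally have "face_poly {S. \<not> vertex_cover E S} = [:1, 1:] ^ M * ?r"
    by (simp only: right_diff_distrib)
  moreover have "poly ?r (- 1) \<noteq> 0"
    using k(2) q(2) alternating_sum_eq_poly[OF k(3)] by (simp add: poly_homogenize power_0_left)
  ultimately show ?thesis unfolding M_def[symmetric] by (rule order_minus_one_eqI)
qed

lemma simplicial_complex_independent:
  "simple_graph E \<Longrightarrow> simplicial_complex {S. independent_set E S}"
  by (auto simp: simplicial_complex_def independent_set_def simple_graph_def)

lemma simplicial_complex_noncovers:
  "E \<noteq> {} \<Longrightarrow> simplicial_complex {S. \<not> vertex_cover E S}"
  by (auto simp: simplicial_complex_def vertex_cover_def)

theorem mainTheorem4:
  fixes E :: "'v::finite set set"
  assumes "simple_graph E"
    and "E \<noteq> {}"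
  shows "a_invariant (cover_ideal E :: ('v, 'k::field) mpoly set)
           = a_invariant (edge_ideal E :: ('v, 'k) mpoly set)
       \<and> a_invariant (edge_ideal E :: ('v, 'k) mpoly set)
           = - int (multiplicity_minus_one E)"
proof -
  let ?I = "{S. independent_set E S}" and ?J = "{S. \<not> vertex_cover E S}"
  note I = simplicial_complex_independent[OF assms(1)]
  have "?I \<noteq> {}" using I by (auto simp: simplicial_complex_def)
  then have "independence_poly E \<noteq> 0" unfolding independence_poly_eq_face_poly by (rule face_poly_nonzero)
  then have "int (multiplicity_minus_one E) = int (Polynomial.order (- 1) (face_poly ?I))"
    by (simp add: multiplicity_minus_one_eq independence_poly_eq_face_poly)
  moreover have "a_invariant (edge_ideal E :: ('v, 'k) mpoly set)
      = - int (Polynomial.order (- 1) (face_poly ?I))"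
    unfolding edge_ideal_stanley_reisner[OF assms(1)] using I by (rule a_invariant_stanley_reisner)
  moreover have "a_invariant (cover_ideal E :: ('v, 'k) mpoly set)
      = - int (Polynomial.order (- 1) (face_poly ?J))"
    unfolding cover_ideal_stanley_reisner using simplicial_complex_noncovers[OF assms(2)]
    by (rule a_invariant_stanley_reisner)
  ultimately show ?thesis by (simp only: order_face_poly_noncovers[OF assms])
qed

end
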